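(* Let $X$ be a germ of a vector field (formal, smooth or analytic, with corresponding coefficient ring $C$) that is normally hyperbolic on a manifold of singularities $\mathcal{N}$, in pre-normal form with $A(u)=\operatorname{diag}(\lambda_1(u),\dots,\lambda_{n-k}(u))$. Then all terms of the form $$\begin{aligned} f(u)\,x^\alpha\partial_{x_i},&\qquad \langle\alpha,\lambda(0)\rangle-\lambda_i(0)\ne0,\\ f(u)\,x^\alpha\partial_{u_i},&\qquad \langle\alpha,\lambda(0)\rangle\neq0, \end{aligned}$$ ($f\in C$, $|\alpha|\ge2$) do not appear in the normal form $\tilde X=X_0+\sum_{d\ge1}\tilde X_d$; that is, the formal series $\hat X$ of $X$ is formally conjugate, by a sequence of transformations generated by $U_d\in C\mathcal{H}_d$, $d\ge1$, to a normal form $\tilde X$ containing no such terms.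
   Context: Let $\mathbb{K}=\mathbb{R}$ or $\mathbb{C}$. $X$ is a germ of a vector field on $\mathbb{K}^n$ that is normally hyperbolic along an invariant manifold $\mathcal{N}$ of dimension $k$ consisting entirely of singular points (normal hyperbolicity: the eigenvalues of the linearisation in the normal directions have nonzero real part). Local coordinates $(x,u)\in\mathbb{K}^{n-k}\times\mathbb{K}^k$ are chosen so that $\mathcal{N}=\{x=0\}$ and $X$ is in pre-normal form $X=(A(u)x+f(x,u))\partial_x+g(x,u)\partial_u$ with $f(0,u)=g(0,u)=0$. Expanding in $x$ only, $X\sim\hat X=X_0+X_1+\cdots$ with $X_0=A(u)x\,\partial_x+0\cdot\partial_u$ and $X_d\in C\mathcal{H}_d$. $C$ is one of the rings $\hat C^\infty(u)$ (formal power series in $u$), $C^\infty(u)$ (germs at $0$ of smooth functions), $C^\omega(u)$ (germs at $0$ of analytic functions). $C\mathcal{H}_d$ is the free $C$-module of $n$-component vector fields whose components are homogeneous polynomials of degree $d+1$ in $x$ with coefficients in $C$. The transformation generated by $U_d$ is its formal time-one flow, which transforms $\hat X$ into $\exp(L_{U_d})\hat X$, $L_{U_d}=[U_d,\cdot]$. The normal form is $\tilde X=X_0+\sum_{d\ge1}\tilde X_d$, where $\tilde X_d\in C\mathcal{H}_d$ is a chosen representative of a class in $\operatorname{coker}(\hat L_d)=C\mathcal{H}_d/\operatorname{Im}(\hat L_d)$, with $\hat L_d(U^x\partial_x+U^u\partial_u)=[X_0,U^x\partial_x]+X_0(U^u)\partial_u$ ($X_0$ acting as a derivation on each component, $[X_0,U]=X_0(U)-U(X_0)$).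 Finally $\lambda(u)=(\lambda_1(u),\dots,\lambda_{n-k}(u))$, $\operatorname{Re}\lambda_i(0)\neq 0$, $\alpha\in\mathbb{N}^{n-k}$, and $\langle\cdot,\cdot\rangle$ is the usual dot product. *)

theory Defs
  imports "HOL-Analysis.Analysis" "HOL-Library.Groups_Big_Fun"
begin

text \<open>
  The base field is a type \<open>'a\<close> of sort \<open>{real_normed_field, euclidean_space}\<close>: up to isomorphism
  these are exactly \<open>real\<close> and \<open>complex\<close>, and in both cases \<open>z \<bullet> 1\<close> is the real part of \<open>z\<close>.
  Coordinates on the ambient space are indexed by \<open>'m + 'k\<close>: \<open>Inl i\<close> stands for $x_i$ and \<open>Inr j\<close>
  for $u_j$, so $n - k$ is \<open>CARD('m)\<close> and $k$ is \<open>CARD('k)\<close>.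
\<close>

definition join :: "'b ^ 'm::finite \<Rightarrow> 'b ^ 'k::finite \<Rightarrow> 'b ^ ('m + 'k)" where
  "join x u = (\<chi> c. case c of Inl i \<Rightarrow> x $ i | Inr j \<Rightarrow> u $ j)"

definition mdeg :: "nat ^ 'm::finite \<Rightarrow> nat" where
  "mdeg \<alpha> = (\<Sum>i\<in>UNIV. \<alpha> $ i)"


section \<open>Multivariate formal power series\<close>

typedef ('c, 'm) mfps = "UNIV :: (nat ^ 'm \<Rightarrow> 'c) set"
  morphisms mcoeff Abs_mfps ..

lemma mfps_eq_iff: "f = g \<longleftrightarrow> (\<forall>\<alpha>. mcoeff f \<alpha> = mcoeff g \<alpha>)"
  by (metis ext mcoeff_inject)

lemma mcoeff_Abs_mfps [simp]: "mcoeff (Abs_mfps f) = f"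
  by (simp add: Abs_mfps_inverse)

lemma finite_mindex_le: "finite {\<alpha> :: nat ^ 'm. \<forall>i. \<alpha> $ i \<le> \<gamma> $ i}"
proof -
  have "finite (PiE (UNIV :: 'm set) (\<lambda>i. {..\<gamma> $ i}))"
    by (intro finite_PiE) auto
  moreover have "{\<alpha> :: nat ^ 'm. \<forall>i. \<alpha> $ i \<le> \<gamma> $ i} \<subseteq> vec_lambda ` PiE UNIV (\<lambda>i. {..\<gamma> $ i})"
  proof
    fix \<alpha> :: "nat ^ 'm" assume "\<alpha> \<in> {\<alpha>. \<forall>i. \<alpha> $ i \<le> \<gamma> $ i}"
    then have "vec_nth \<alpha> \<in> PiE UNIV (\<lambda>i. {..\<gamma> $ i})" by auto
    then have "vec_lambda (vec_nth \<alpha>) \<in> vec_lambda ` PiE UNIV (\<lambda>i. {..\<gamma> $ i})" by (rule imageI)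
    then show "\<alpha> \<in> vec_lambda ` PiE UNIV (\<lambda>i. {..\<gamma> $ i})" by simp
  qed
  ultimately show ?thesis by (rule finite_surj)
qed

lemma finite_mindex_sum: "finite {(\<alpha>, \<beta>). \<alpha> + \<beta> = (\<gamma> :: nat ^ 'm)}"
proof -
  have "{(\<alpha>, \<beta>). \<alpha> + \<beta> = \<gamma>} \<subseteq> {\<alpha>. \<forall>i. \<alpha> $ i \<le> \<gamma> $ i} \<times> {\<alpha>. \<forall>i. \<alpha> $ i \<le> \<gamma> $ i}"
    by auto
  then show ?thesis by (rule finite_subset) (simp add: finite_mindex_le)
qed

instantiation mfps :: (zero, finite) zero
begin
definition "0 = Abs_mfps (\<lambda>_. 0)"
instance ..
end

instantiation mfps :: ("{zero, one}", finite) one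
begin
definition "1 = Abs_mfps (\<lambda>\<alpha>. if \<alpha> = 0 then 1 else 0)"
instance ..
end

instantiation mfps :: (plus, finite) plus
begin
definition "f + g = Abs_mfps (\<lambda>\<alpha>. mcoeff f \<alpha> + mcoeff g \<alpha>)"
instance ..
end

instantiation mfps :: (minus, finite) minus
begin
definition "f - g = Abs_mfps (\<lambda>\<alpha>. mcoeff f \<alpha> - mcoeff g \<alpha>)"
instance ..
end

instantiation mfps :: (uminus, finite) uminus
begin
definition "- f = Abs_mfps (\<lambda>\<alpha>. - mcoeff f \<alpha>)"
instance ..
end

instantiation mfps :: ("{comm_monoid_add, times}", finite) times
begin
definition "f * g = Abs_mfps (\<lambda>\<gamma>. \<Sum>(\<alpha>, \<beta>) \<in> {(\<alpha>, \<beta>). \<alpha> + \<beta> = \<gamma>}. mcoeff f \<alpha> * mcoeff g \<beta>)"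
instance ..
end

instantiation mfps :: (scaleR, finite) scaleR
begin
definition "r *\<^sub>R f = Abs_mfps (\<lambda>\<alpha>. r *\<^sub>R mcoeff f \<alpha>)"
instance ..
end

lemma mcoeff_simps [simp]:
  "mcoeff 0 \<alpha> = 0"
  "mcoeff 1 \<alpha> = (if \<alpha> = 0 then 1 else 0)"
  "mcoeff (f + g) \<alpha> = mcoeff f \<alpha> + mcoeff g \<alpha>"
  "mcoeff (f' - g') \<alpha> = mcoeff f' \<alpha> - mcoeff g' \<alpha>"
  "mcoeff (- h) \<alpha> = - mcoeff h \<alpha>"
  "mcoeff (r *\<^sub>R h') \<alpha> = r *\<^sub>R mcoeff h' \<alpha>"
  by (simp_all add: zero_mfps_def one_mfps_def plus_mfps_def minus_mfps_def uminus_mfps_def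
      scaleR_mfps_def)

lemma mcoeff_mult:
  "mcoeff (f * g) \<gamma> = (\<Sum>(\<alpha>, \<beta>) \<in> {(\<alpha>, \<beta>). \<alpha> + \<beta> = \<gamma>}. mcoeff f \<alpha> * mcoeff g \<beta>)"
  by (simp add: times_mfps_def)

instance mfps :: (comm_monoid_add, finite) comm_monoid_add
  by standard (auto simp: mfps_eq_iff algebra_simps)

instance mfps :: (ab_group_add, finite) ab_group_add
  by standard (auto simp: mfps_eq_iff algebra_simps)

instance mfps :: (real_vector, finite) real_vector
  by standard (auto simp: mfps_eq_iff algebra_simps)

instance mfps :: (comm_ring_1, finite) comm_ring_1
proof
  fix f g h :: "('a, 'b) mfps"
  show "f * g * h = f * (g * h)"
  proof (unfold mfps_eq_iff, intro allI)
    fix \<gamma> :: "nat ^ 'b"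
    let ?D = "\<lambda>\<gamma> :: nat ^ 'b. {(\<alpha>, \<beta>). \<alpha> + \<beta> = \<gamma>}"
    have "mcoeff (f * g * h) \<gamma> =
        (\<Sum>p\<in>?D \<gamma>. \<Sum>q\<in>?D (fst p). mcoeff f (fst q) * mcoeff g (snd q) * mcoeff h (snd p))"
      by (simp add: mcoeff_mult sum_distrib_right case_prod_unfold)
    also have "\<dots> = (\<Sum>(p, q)\<in>Sigma (?D \<gamma>) (\<lambda>p. ?D (fst p)).
        mcoeff f (fst q) * mcoeff g (snd q) * mcoeff h (snd p))"
      by (rule sum.Sigma) (use finite_mindex_sum in auto)
    also have "\<dots> = (\<Sum>(p, q)\<in>Sigma (?D \<gamma>) (\<lambda>p. ?D (snd p)).
        mcoeff f (fst p) * (mcoeff g (fst q) * mcoeff h (snd q)))"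
      by (rule sum.reindex_bij_witness[where
            i = "\<lambda>(p, q). ((fst p + fst q, snd q), (fst p, fst q))" and
            j = "\<lambda>(p, q). ((fst q, snd q + snd p), (snd q, snd p))"])
        (auto simp: algebra_simps)
    also have "\<dots> =
        (\<Sum>p\<in>?D \<gamma>. \<Sum>q\<in>?D (snd p). mcoeff f (fst p) * (mcoeff g (fst q) * mcoeff h (snd q)))"
      by (rule sum.Sigma[symmetric]) (use finite_mindex_sum in auto)
    also have "\<dots> = mcoeff (f * (g * h)) \<gamma>"
      by (simp add: mcoeff_mult sum_distrib_left case_prod_unfold)
    finally show "mcoeff (f * g * h) \<gamma> = mcoeff (f * (g * h)) \<gamma>" .
  qed
  show "f * g = g * f"
  proof (unfold mfps_eq_iff mcoeff_mult, intro allI)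
    fix \<gamma> :: "nat ^ 'b"
    show "(\<Sum>(\<alpha>, \<beta>) \<in> {(\<alpha>, \<beta>). \<alpha> + \<beta> = \<gamma>}. mcoeff f \<alpha> * mcoeff g \<beta>) =
        (\<Sum>(\<alpha>, \<beta>) \<in> {(\<alpha>, \<beta>). \<alpha> + \<beta> = \<gamma>}. mcoeff g \<alpha> * mcoeff f \<beta>)"
      by (rule sum.reindex_bij_witness[where i = prod.swap and j = prod.swap])
        (auto simp: algebra_simps)
  qed
  show "1 * f = f"
  proof (unfold mfps_eq_iff mcoeff_mult, intro allI)
    fix \<gamma> :: "nat ^ 'b"
    have "(\<Sum>(\<alpha>, \<beta>) \<in> {(\<alpha>, \<beta>). \<alpha> + \<beta> = \<gamma>}. mcoeff 1 \<alpha> * mcoeff f \<beta>) =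
        (\<Sum>(\<alpha>, \<beta>) \<in> {(0 :: nat ^ 'b, \<gamma>)}. mcoeff 1 \<alpha> * mcoeff f \<beta>)"
      by (rule sum.mono_neutral_right) (use finite_mindex_sum in \<open>auto split: if_splits\<close>)
    then show "(\<Sum>(\<alpha>, \<beta>) \<in> {(\<alpha>, \<beta>). \<alpha> + \<beta> = \<gamma>}. mcoeff 1 \<alpha> * mcoeff f \<beta>) = mcoeff f \<gamma>"
      by simp
  qed
  show "(f + g) * h = f * h + g * h"
    by (simp add: mfps_eq_iff mcoeff_mult distrib_right case_prod_unfold sum.distrib)
  show "(0 :: ('a, 'b) mfps) \<noteq> 1"
    by (auto simp: mfps_eq_iff)
qed

instance mfps :: ("{real_algebra_1, comm_ring_1}", finite) real_algebra_1
  by standard (simp_all add: mfps_eq_iff mcoeff_mult scaleR_sum_right case_prod_unfold)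

definition mmonom :: "nat ^ 'm \<Rightarrow> 'c::zero \<Rightarrow> ('c, 'm) mfps" where
  "mmonom \<alpha> c = Abs_mfps (\<lambda>\<beta>. if \<beta> = \<alpha> then c else 0)"

definition mpd :: "'m::finite \<Rightarrow> ('c::semiring_1, 'm) mfps \<Rightarrow> ('c, 'm) mfps" where
  "mpd i f = Abs_mfps (\<lambda>\<alpha>. of_nat (\<alpha> $ i + 1) * mcoeff f (\<alpha> + axis i 1))"

definition mmap :: "('c \<Rightarrow> 'd) \<Rightarrow> ('c, 'm::finite) mfps \<Rightarrow> ('d, 'm) mfps" where
  "mmap h f = Abs_mfps (\<lambda>\<alpha>. h (mcoeff f \<alpha>))"


section \<open>Germs of functions\<close>

quotient_type (overloaded) ('a, 'n) germ =
  "('a::real_normed_field) ^ ('n::finite) \<Rightarrow> 'a" / "\<lambda>f g. \<forall>\<^sub>F u in nhds 0. f u = g u"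
  morphisms rep_germ germ_of
proof (rule equivpI)
  show "reflp (\<lambda>f g :: 'a ^ 'n \<Rightarrow> 'a. \<forall>\<^sub>F u in nhds 0. f u = g u)"
    by (auto intro: reflpI)
  show "symp (\<lambda>f g :: 'a ^ 'n \<Rightarrow> 'a. \<forall>\<^sub>F u in nhds 0. f u = g u)"
    by (auto intro!: sympI elim: eventually_mono)
  show "transp (\<lambda>f g :: 'a ^ 'n \<Rightarrow> 'a. \<forall>\<^sub>F u in nhds 0. f u = g u)"
    by (auto intro!: transpI elim: eventually_elim2)
qed

instantiation germ :: (real_normed_field, finite) comm_ring_1
begin
lift_definition zero_germ :: "('a, 'b) germ" is "\<lambda>_. 0" .
lift_definition one_germ :: "('a, 'b) germ" is "\<lambda>_. 1" .
lift_definition plus_germ :: "('a, 'b) germ \<Rightarrow> ('a, 'b) germ \<Rightarrow> ('a, 'b) germ"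
  is "\<lambda>f g u. f u + g u" by (auto elim: eventually_elim2)
lift_definition minus_germ :: "('a, 'b) germ \<Rightarrow> ('a, 'b) germ \<Rightarrow> ('a, 'b) germ"
  is "\<lambda>f g u. f u - g u" by (auto elim: eventually_elim2)
lift_definition uminus_germ :: "('a, 'b) germ \<Rightarrow> ('a, 'b) germ"
  is "\<lambda>f u. - f u" by (auto elim: eventually_mono)
lift_definition times_germ :: "('a, 'b) germ \<Rightarrow> ('a, 'b) germ \<Rightarrow> ('a, 'b) germ"
  is "\<lambda>f g u. f u * g u" by (auto elim: eventually_elim2)
instance
  by standard (transfer; simp add: algebra_simps)+
end

instantiation germ :: (real_normed_field, finite) real_algebra_1
begin
lift_definition scaleR_germ :: "real \<Rightarrow> ('a, 'b) germ \<Rightarrow> ('a, 'b) germ"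
  is "\<lambda>r f u. r *\<^sub>R f u" by (auto elim: eventually_mono)
instance
  by standard (transfer; simp add: algebra_simps)+
end

definition pd :: "'n::finite \<Rightarrow> ('a::real_normed_field ^ 'n \<Rightarrow> 'a) \<Rightarrow> 'a ^ 'n \<Rightarrow> 'a" where
  "pd j f u = deriv (\<lambda>t. f (u + axis j t)) 0"

lemma tendsto_add_axis: "((\<lambda>t. u + axis j t) \<longlongrightarrow> u) (nhds (0 :: 'a::real_normed_field))"
proof (rule vec_tendstoI)
  fix i
  have "((\<lambda>t. u $ i + axis j t $ i) \<longlongrightarrow> u $ i + 0) (nhds (0::'a))"
    by (intro tendsto_add tendsto_const)
      (cases "i = j"; simp add: axis_def filterlim_ident)
  then show "((\<lambda>t. (u + axis j t) $ i) \<longlongrightarrow> u $ i) (nhds (0::'a))"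
    by simp
qed

lemma pd_cong_eventually:
  assumes "\<forall>\<^sub>F u in nhds a. f u = g u"
  shows "\<forall>\<^sub>F u in nhds a. pd j f u = pd j g u"
proof -
  have "\<forall>\<^sub>F u in nhds a. \<forall>\<^sub>F v in nhds u. f v = g v"
    using assms by (simp add: eventually_eventually)
  then show ?thesis
  proof eventually_elim
    case (elim u)
    have "\<forall>\<^sub>F t in nhds 0. f (u + axis j t) = g (u + axis j t)"
      using tendsto_add_axis elim by (rule eventually_compose_filterlim[rotated])
    then show ?case
      unfolding pd_def deriv_def by (simp cong: DERIV_cong_ev)
  qed
qed

lift_definition germ_pd :: "'n \<Rightarrow> ('a::real_normed_field, 'n::finite) germ \<Rightarrow> ('a, 'n) germ"
  is pd by (rule pd_cong_eventually)

lift_definition germ_at0 :: "('a::real_normed_field, 'n::finite) germ \<Rightarrow> 'a"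
  is "\<lambda>f. f 0" by (rule eventually_nhds_x_imp_x)

lemma tendsto_join_0:
  "((\<lambda>u. join (0 :: 'a ^ 'm::finite) u) \<longlongrightarrow> 0) (nhds (0 :: 'a::real_normed_field ^ 'k::finite))"
proof (rule vec_tendstoI)
  fix c :: "'m + 'k"
  have "((\<lambda>u. u $ j) \<longlongrightarrow> 0 $ j) (nhds (0 :: 'a ^ 'k))" for j
    by (intro tendsto_vec_nth filterlim_ident)
  then show "((\<lambda>u. join (0 :: 'a ^ 'm) u $ c) \<longlongrightarrow> 0 $ c) (nhds (0 :: 'a ^ 'k))"
    by (cases c) (simp_all add: join_def)
qed

lift_definition germ_restrict ::
    "('a::real_normed_field, 'm::finite + 'k::finite) germ \<Rightarrow> ('a, 'k) germ"
  is "\<lambda>f u. f (join 0 u)"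
  using tendsto_join_0 by (rule eventually_compose_filterlim[rotated])

text \<open>
  Smoothness is relative to the base field: all iterated partial derivatives with respect to the
  coordinates exist and are continuous. Over the complex numbers these are complex derivatives.
\<close>

definition smooth_on_nbhd :: "('a::real_normed_field ^ 'n::finite) set \<Rightarrow> ('a ^ 'n \<Rightarrow> 'a) \<Rightarrow> bool" where
  "smooth_on_nbhd S f \<longleftrightarrow> (\<forall>js. continuous_on S (foldr pd js f) \<and>
     (\<forall>j. \<forall>u\<in>S. (\<lambda>t. foldr pd js f (u + axis j t)) field_differentiable (at 0)))"

definition smooth_germs :: "('a::real_normed_field, 'n::finite) germ set" where
  "smooth_germs = germ_of ` {f. \<exists>S. open S \<and> 0 \<in> S \<and> smooth_on_nbhd S f}"

definition analytic_germs :: "('a::real_normed_field, 'n::finite) germ set" where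
  "analytic_germs = germ_of ` {f. \<exists>a r. 0 < r \<and> (\<forall>u. (\<forall>j. norm (u $ j) < r) \<longrightarrow>
     ((\<lambda>\<alpha> :: nat ^ 'n. a \<alpha> * (\<Prod>j\<in>UNIV. u $ j ^ \<alpha> $ j)) has_sum f u) UNIV)}"


section \<open>Coefficient rings\<close>

text \<open>
  A coefficient ring consists of a set of coefficients inside an ambient ring \<open>'c\<close>, the partial
  derivatives with respect to $u$, and evaluation at $u = 0$.
\<close>

record ('c, 'k, 'a) coeff_ring =
  coeffs :: "'c set"
  du :: "'k \<Rightarrow> 'c \<Rightarrow> 'c"
  at0 :: "'c \<Rightarrow> 'a"

definition formal_ring :: "(('a::real_normed_field, 'k::finite) mfps, 'k, 'a) coeff_ring" where
  "formal_ring = \<lparr>coeffs = UNIV, du = mpd, at0 = (\<lambda>f. mcoeff f 0)\<rparr>"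

definition smooth_ring :: "(('a::real_normed_field, 'k::finite) germ, 'k, 'a) coeff_ring" where
  "smooth_ring = \<lparr>coeffs = smooth_germs, du = germ_pd, at0 = germ_at0\<rparr>"

definition analytic_ring :: "(('a::real_normed_field, 'k::finite) germ, 'k, 'a) coeff_ring" where
  "analytic_ring = \<lparr>coeffs = analytic_germs, du = germ_pd, at0 = germ_at0\<rparr>"


section \<open>Vector fields expanded in x\<close>

text \<open>
  The components of a vector field are power series in $x$ whose coefficients depend on $u$.
\<close>

type_synonym ('c, 'm, 'k) xfield = "(('c, 'm) mfps) ^ ('m + 'k)"

text \<open>
  The Taylor expansion in $x$ along $x = 0$: the coefficient of $x^\alpha$ is
  $\partial_x^\alpha X(0,u) / \alpha!$. The list \<open>js\<close> only fixes the order in which the partial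
  derivatives are taken, which is immaterial for smooth germs.
\<close>

definition germ_dx :: "nat ^ 'm::finite \<Rightarrow> ('a::real_normed_field, 'm::finite + 'k::finite) germ \<Rightarrow>
    ('a, 'm + 'k) germ" where
  "germ_dx \<alpha> F =
     (let js = (SOME js. \<forall>i. count_list js i = \<alpha> $ i) in foldr germ_pd (map Inl js) F)"

definition germ_expansion :: "('a::real_normed_field, 'm::finite + 'k::finite) germ ^ ('m + 'k) \<Rightarrow>
    (('a, 'k) germ, 'm, 'k) xfield" where
  "germ_expansion X = (\<chi> c. Abs_mfps (\<lambda>\<alpha>.
     (1 / (\<Prod>i\<in>UNIV. fact (\<alpha> $ i))) *\<^sub>R germ_restrict (germ_dx \<alpha> (X $ c))))"

definition formal_expansion :: "('a, 'm::finite + 'k::finite) mfps ^ ('m + 'k) \<Rightarrow>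
    (('a, 'k) mfps, 'm, 'k) xfield" where
  "formal_expansion X = (\<chi> c. Abs_mfps (\<lambda>\<alpha>. Abs_mfps (\<lambda>\<beta>. mcoeff (X $ c) (join \<alpha> \<beta>))))"

definition vf_apply :: "('c::comm_ring_1, 'k, 'a) coeff_ring \<Rightarrow> ('c, 'm::finite, 'k::finite) xfield \<Rightarrow>
    ('c, 'm) mfps \<Rightarrow> ('c, 'm) mfps" where
  "vf_apply C X h =
     (\<Sum>i\<in>UNIV. X $ Inl i * mpd i h) + (\<Sum>j\<in>UNIV. X $ Inr j * mmap (du C j) h)"

definition bracket :: "('c::comm_ring_1, 'k, 'a) coeff_ring \<Rightarrow> ('c, 'm::finite, 'k::finite) xfield \<Rightarrow>
    ('c, 'm, 'k) xfield \<Rightarrow> ('c, 'm, 'k) xfield" where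
  "bracket C X Y = (\<chi> c. vf_apply C X (Y $ c) - vf_apply C Y (X $ c))"

text \<open>
  $\exp(L_U) X = \sum_n L_U^n X / n!$, computed coefficientwise. When \<open>U\<close> has order at least two
  in $x$, only finitely many \<open>n\<close> contribute to each coefficient (\<open>Sum_any\<close> is the sum over the
  finite support).
\<close>

definition exp_ad :: "('c::{comm_ring_1, real_algebra_1}, 'k, 'a) coeff_ring \<Rightarrow>
    ('c, 'm::finite, 'k::finite) xfield \<Rightarrow> ('c, 'm, 'k) xfield \<Rightarrow> ('c, 'm, 'k) xfield" where
  "exp_ad C U X = (\<chi> c. Abs_mfps (\<lambda>\<alpha>.
     Sum_any (\<lambda>n. (1 / fact n) *\<^sub>R mcoeff ((bracket C U ^^ n) X $ c) \<alpha>)))"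

definition homogeneous_fields :: "('c::zero, 'k, 'a) coeff_ring \<Rightarrow> nat \<Rightarrow>
    ('c, 'm::finite, 'k::finite) xfield set" where
  "homogeneous_fields C d = {V. \<forall>c \<alpha>. mcoeff (V $ c) \<alpha> \<in> coeffs C \<and>
     (mdeg \<alpha> \<noteq> d + 1 \<longrightarrow> mcoeff (V $ c) \<alpha> = 0)}"

definition homogeneous_part :: "nat \<Rightarrow> ('c::zero, 'm::finite, 'k::finite) xfield \<Rightarrow>
    ('c, 'm, 'k) xfield" where
  "homogeneous_part d X =
     (\<chi> c. Abs_mfps (\<lambda>\<alpha>. if mdeg \<alpha> = d + 1 then mcoeff (X $ c) \<alpha> else 0))"

definition X0 :: "('m::finite \<Rightarrow> 'c::zero) \<Rightarrow> ('c, 'm::finite, 'k::finite) xfield" where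
  "X0 lam = (\<chi> c. case c of Inl i \<Rightarrow> mmonom (axis i 1) (lam i) | Inr j \<Rightarrow> 0)"

text \<open>
  The expansion has the form $X_0 + X_1 + \cdots$ with $X_0 = \mathrm{diag}(\lambda(u))\,x\,\partial_x$,
  i.e. it vanishes on $x = 0$ and its part linear in $x$ is $X_0$.
\<close>

definition pre_normal_form :: "('m \<Rightarrow> 'c::zero) \<Rightarrow> ('c, 'm::finite, 'k::finite) xfield \<Rightarrow> bool" where
  "pre_normal_form lam X \<longleftrightarrow>
     (\<forall>c. mcoeff (X $ c) 0 = 0) \<and> homogeneous_part 0 X = X0 lam"

text \<open>
  For $A(u) = \mathrm{diag}(\lambda_1(u), \dots)$ the eigenvalues in the normal directions at $u = 0$
  are the $\lambda_i(0)$; \<open>\<bullet> 1\<close> takes their real part.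
\<close>

definition normally_hyperbolic ::
    "('c, 'k, 'a::{real_normed_field, euclidean_space}) coeff_ring \<Rightarrow> ('m \<Rightarrow> 'c) \<Rightarrow> bool" where
  "normally_hyperbolic C lam \<longleftrightarrow> (\<forall>i. at0 C (lam i) \<bullet> 1 \<noteq> 0)"


section \<open>Normal forms\<close>

definition x_part :: "('c::zero, 'm::finite, 'k::finite) xfield \<Rightarrow> ('c, 'm, 'k) xfield" where
  "x_part U = (\<chi> c. case c of Inl i \<Rightarrow> U $ Inl i | Inr j \<Rightarrow> 0)"

definition L_hat :: "('c::comm_ring_1, 'k, 'a) coeff_ring \<Rightarrow> ('m \<Rightarrow> 'c) \<Rightarrow>
    ('c, 'm::finite, 'k::finite) xfield \<Rightarrow> ('c, 'm, 'k) xfield" where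
  "L_hat C lam U = bracket C (X0 lam) (x_part U) +
     (\<chi> c. case c of Inl i \<Rightarrow> 0 | Inr j \<Rightarrow> vf_apply C (X0 lam) (U $ Inr j))"

definition coker :: "('c::comm_ring_1, 'k, 'a) coeff_ring \<Rightarrow> ('m \<Rightarrow> 'c) \<Rightarrow> nat \<Rightarrow>
    ('c, 'm::finite, 'k::finite) xfield set set" where
  "coker C lam d = homogeneous_fields C d //
     {(V, W). V \<in> homogeneous_fields C d \<and> W \<in> homogeneous_fields C d \<and>
        V - W \<in> L_hat C lam ` homogeneous_fields C d}"

definition no_nonresonant_terms :: "('c::zero, 'k, 'a::real_normed_field) coeff_ring \<Rightarrow>
    ('m \<Rightarrow> 'c) \<Rightarrow> ('c, 'm::finite, 'k::finite) xfield \<Rightarrow> bool" where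
  "no_nonresonant_terms C lam X \<longleftrightarrow> (\<forall>\<alpha>. mdeg \<alpha> \<ge> 2 \<longrightarrow>
     (\<forall>i. (\<Sum>l\<in>UNIV. of_nat (\<alpha> $ l) * at0 C (lam l)) - at0 C (lam i) \<noteq> 0 \<longrightarrow>
        mcoeff (X $ Inl i) \<alpha> = 0) \<and>
     (\<forall>j. (\<Sum>l\<in>UNIV. of_nat (\<alpha> $ l) * at0 C (lam l)) \<noteq> 0 \<longrightarrow>
        mcoeff (X $ Inr j) \<alpha> = 0))"

text \<open>
  \<open>rep d\<close> chooses, for each class in the cokernel in degree \<open>d\<close>, a representative of that class.
\<close>

definition normal_form_style :: "('c::comm_ring_1, 'k, 'a) coeff_ring \<Rightarrow> ('m \<Rightarrow> 'c) \<Rightarrow>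
    (nat \<Rightarrow> ('c, 'm::finite, 'k::finite) xfield set \<Rightarrow> ('c, 'm, 'k) xfield) \<Rightarrow> bool" where
  "normal_form_style C lam rep \<longleftrightarrow> (\<forall>d\<ge>1. \<forall>K\<in>coker C lam d. rep d K \<in> K)"

definition normal_form :: "('c::comm_ring_1, 'k, 'a) coeff_ring \<Rightarrow> ('m \<Rightarrow> 'c) \<Rightarrow>
    (nat \<Rightarrow> ('c, 'm::finite, 'k::finite) xfield set \<Rightarrow> ('c, 'm, 'k) xfield) \<Rightarrow>
    ('c, 'm, 'k) xfield \<Rightarrow> bool" where
  "normal_form C lam rep X \<longleftrightarrow> pre_normal_form lam X \<and>
     (\<forall>d\<ge>1. homogeneous_part d X \<in> rep d ` coker C lam d)"

text \<open>
  The result of applying the transformations generated by \<open>U 1\<close>, \<dots>, \<open>U d\<close>, in this order.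
\<close>

primrec transformed :: "('c::{comm_ring_1, real_algebra_1}, 'k, 'a) coeff_ring \<Rightarrow>
    (nat \<Rightarrow> ('c, 'm::finite, 'k::finite) xfield) \<Rightarrow> ('c, 'm, 'k) xfield \<Rightarrow> nat \<Rightarrow>
    ('c, 'm, 'k) xfield" where
  "transformed C U X 0 = X"
| "transformed C U X (Suc d) = exp_ad C (U (Suc d)) (transformed C U X d)"

text \<open>
  Convergence of the sequence of transformed fields is in the \<open>x\<close>-adic sense: each coefficient
  is eventually stationary.
\<close>

definition formally_conjugate :: "('c::{comm_ring_1, real_algebra_1}, 'k, 'a) coeff_ring \<Rightarrow>
    ('c, 'm::finite, 'k::finite) xfield \<Rightarrow> ('c, 'm, 'k) xfield \<Rightarrow> bool" where
  "formally_conjugate C X Y \<longleftrightarrow> (\<exists>U. (\<forall>d\<ge>1. U d \<in> homogeneous_fields C d) \<and>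
     (\<forall>c \<alpha>. \<forall>\<^sub>F d in sequentially. mcoeff (transformed C U X d $ c) \<alpha> = mcoeff (Y $ c) \<alpha>))"

definition nonresonant_terms_removable ::
    "('c::{comm_ring_1, real_algebra_1}, 'k, 'a::real_normed_field) coeff_ring \<Rightarrow> ('m \<Rightarrow> 'c) \<Rightarrow>
     ('c, 'm::finite, 'k::finite) xfield \<Rightarrow> bool" where
  "nonresonant_terms_removable C lam X \<longleftrightarrow> (\<exists>rep. normal_form_style C lam rep \<and>
     (\<forall>d\<ge>1. \<forall>K\<in>coker C lam d. no_nonresonant_terms C lam (rep d K)) \<and>
     (\<exists>Y. formally_conjugate C X Y \<and> normal_form C lam rep Y \<and> no_nonresonant_terms C lam Y))"

end

theory Submission
  imports Defs
begin

text \<open>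
  Write a field as $X_0 + X_1 + \cdots$ by degree in $x$. Bracketing with a field $U_d$ of degree
  $d \ge 1$ raises this degree by at least $d$, so $\exp(L_{U_d})$ leaves $X_1, \dots, X_{d-1}$ alone
  and changes $X_d$ by the degree $d$ part of $[U_d, X_0]$. That part is $-\hat L_d(U_d)$: the whole
  bracket also contains the terms in which the $\partial_u$ components of $U_d$ differentiate the
  $\lambda_i(u)$, but these carry the factor $x_i$ of $X_0$ and so have degree $d + 1$. Hence one step moves $X_d$ to any prescribed
  member of its class modulo the image of $\hat L_d$, and the infinite composition converges because
  the coefficient of $x^\alpha$ no longer changes once $d \ge |\alpha|$.

  It remains to see that each class has a member without nonresonant terms. On monomials $\hat L_d$
  is diagonal: it multiplies $f(u)\,x^\alpha \partial_{x_i}$ by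
  $\langle\alpha,\lambda(u)\rangle - \lambda_i(u)$ and $f(u)\,x^\alpha\partial_{u_j}$ by
  $\langle\alpha,\lambda(u)\rangle$. No derivative of $f$ enters, since $X_0$ has no $\partial_u$
  component. If the eigenvalue is nonzero at $u = 0$ it is a unit of the coefficient ring, so every
  such term lies in the image.

  The argument uses few properties of the coefficients: closure under the ring operations and
  $\partial_{u_j}$, additivity of $\partial_{u_j}$ and of evaluation at $0$, and invertibility of
  the elements that do not vanish at $0$. They form the locale \<open>coefficient_ring\<close>, in which
  \<open>nonresonant_terms_removable_if_over\<close> carries out the induction. The rest of the work is to
  show that the three concrete rings are instances. Formal power series are inverted by the
  geometric series (\<open>geometric_series\<close>). For smooth germs, closure follows by coinduction from
  the sum, product and reciprocal rules (\<open>smooth_closure_step\<close>). Analytic germs are sums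
  of absolutely convergent power series. Here one needs the Cauchy product
  (\<open>cauchy_product_has_sum\<close>), termwise differentiation (\<open>pd_psum\<close>), and a bound on the
  coefficients of the formal inverse that makes it converge (\<open>summable_at_geometric\<close>).
\<close>

section \<open>Multi-indices and formal power series\<close>

lemma mdeg_add [simp]: "mdeg (\<alpha> + \<beta>) = mdeg \<alpha> + mdeg \<beta>"
  by (simp add: mdeg_def sum.distrib)

lemma mdeg_0 [simp]: "mdeg 0 = 0"
  by (simp add: mdeg_def)

lemma mdeg_axis [simp]: "mdeg (axis i n) = n"
  by (simp add: mdeg_def axis_def)

lemma mdeg_eq_0_iff [simp]: "mdeg \<alpha> = 0 \<longleftrightarrow> \<alpha> = 0"
  by (auto simp: mdeg_def vec_eq_iff)

lemma mcoeff_mmonom [simp]: "mcoeff (mmonom \<alpha> c) \<beta> = (if \<beta> = \<alpha> then c else 0)"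
  by (simp add: mmonom_def)

lemma mcoeff_mpd [simp]: "mcoeff (mpd i f) \<alpha> = of_nat (\<alpha> $ i + 1) * mcoeff f (\<alpha> + axis i 1)"
  by (simp add: mpd_def)

lemma mcoeff_mmap [simp]: "mcoeff (mmap h f) \<alpha> = h (mcoeff f \<alpha>)"
  by (simp add: mmap_def)

lemma mcoeff_sum [simp]: "mcoeff (\<Sum>i\<in>A. f i) \<alpha> = (\<Sum>i\<in>A. mcoeff (f i) \<alpha>)"
  by (induction A rule: infinite_finite_induct) auto

lemma mpd_add: "mpd i (f + g) = mpd i f + mpd i g"
  by (simp add: mfps_eq_iff algebra_simps)

lemma mpd_0 [simp]: "mpd i 0 = 0"
  by (simp add: mfps_eq_iff)

lemma mcoeff_mmonom_mult:
  fixes h :: "('c::comm_ring_1, 'm::finite) mfps"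
  shows "mcoeff (mmonom \<beta> c * h) (\<beta> + \<gamma>) = c * mcoeff h \<gamma>"
proof -
  have "mcoeff (mmonom \<beta> c * h) (\<beta> + \<gamma>) =
      (\<Sum>(\<alpha>, \<delta>) \<in> {(\<beta>, \<gamma>)}. mcoeff (mmonom \<beta> c) \<alpha> * mcoeff h \<delta>)"
    unfolding mcoeff_mult
    by (rule sum.mono_neutral_right) (use finite_mindex_sum in \<open>auto split: if_splits\<close>)
  then show ?thesis by simp
qed

lemma mcoeff_const_mult [simp]: "mcoeff (mmonom 0 c * h) \<gamma> = c * mcoeff h \<gamma>"
  for h :: "('c::comm_ring_1, 'm::finite) mfps"
  using mcoeff_mmonom_mult[of 0 c h \<gamma>] by simp

lemma mcoeff_mmonom_mult_eq_0:
  fixes h :: "('c::comm_ring_1, 'm::finite) mfps"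
  assumes "\<not> \<beta> \<le> \<gamma>"
  shows "mcoeff (mmonom \<beta> c * h) \<gamma> = 0"
  unfolding mcoeff_mult using assms
  by (intro sum.neutral) (auto simp: less_eq_vec_def)

text \<open>
  Each $x_l \partial_{x_l}$ acts diagonally on monomials; this is why $X_0$ does.
\<close>

lemma mcoeff_euler:
  fixes h :: "('c::comm_ring_1, 'm::finite) mfps"
  shows "mcoeff (mmonom (axis l 1) c * mpd l h) \<alpha> = of_nat (\<alpha> $ l) * c * mcoeff h \<alpha>"
proof (cases "\<alpha> $ l = 0")
  case True
  then have "\<not> axis l 1 \<le> \<alpha>"
    by (auto simp: less_eq_vec_def axis_def intro!: exI[of _ l])
  then show ?thesis using True by (simp add: mcoeff_mmonom_mult_eq_0)
next
  case False
  define \<beta> where "\<beta> = \<alpha> - axis l 1"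
  have \<alpha>: "\<alpha> = axis l 1 + \<beta>"
    using False by (auto simp: \<beta>_def vec_eq_iff axis_def)
  show ?thesis
    unfolding \<alpha> mcoeff_mmonom_mult by (simp add: algebra_simps axis_def)
qed

text \<open>
  Vanishing to order \<open>n\<close> in $x$; a field of degree at least $d$ has components of order $d + 1$.
\<close>

definition order_ge :: "nat \<Rightarrow> ('c::zero, 'm::finite) mfps \<Rightarrow> bool" where
  "order_ge n f \<longleftrightarrow> (\<forall>\<alpha>. mdeg \<alpha> < n \<longrightarrow> mcoeff f \<alpha> = 0)"

lemma order_geD: "order_ge n f \<Longrightarrow> mdeg \<alpha> < n \<Longrightarrow> mcoeff f \<alpha> = 0"
  by (simp add: order_ge_def)

lemma order_ge_mono: "order_ge n f \<Longrightarrow> m \<le> n \<Longrightarrow> order_ge m f"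
  by (simp add: order_ge_def)

lemma order_ge_add: "order_ge n f \<Longrightarrow> order_ge n g \<Longrightarrow> order_ge n (f + g)"
  for f :: "('c::comm_monoid_add, 'm::finite) mfps"
  by (simp add: order_ge_def)

lemma order_ge_diff: "order_ge n f \<Longrightarrow> order_ge n g \<Longrightarrow> order_ge n (f - g)"
  for f :: "('c::ab_group_add, 'm::finite) mfps"
  by (simp add: order_ge_def)

lemma order_ge_sum: "(\<And>i. i \<in> A \<Longrightarrow> order_ge n (f i)) \<Longrightarrow> order_ge n (\<Sum>i\<in>A. f i)"
  for f :: "'i \<Rightarrow> ('c::comm_monoid_add, 'm::finite) mfps"
  by (simp add: order_ge_def)

lemma order_ge_mult:
  fixes f g :: "('c::comm_ring_1, 'm::finite) mfps"
  assumes "order_ge m f" "order_ge n g"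
  shows "order_ge (m + n) (f * g)"
  unfolding order_ge_def mcoeff_mult
proof (intro allI impI sum.neutral ballI)
  fix \<gamma> :: "nat ^ 'm" and p
  assume "mdeg \<gamma> < m + n" "p \<in> {(\<alpha>, \<beta>). \<alpha> + \<beta> = \<gamma>}"
  then have "mdeg (fst p) < m \<or> mdeg (snd p) < n" by auto
  then show "(case p of (\<alpha>, \<beta>) \<Rightarrow> mcoeff f \<alpha> * mcoeff g \<beta>) = 0"
    using assms by (auto simp: order_ge_def case_prod_unfold)
qed

lemma order_ge_mpd: "order_ge (Suc n) f \<Longrightarrow> order_ge n (mpd i f)"
  for f :: "('c::comm_ring_1, 'm::finite) mfps"
  by (simp add: order_ge_def)

section \<open>The linear part\<close>

lemma X0_Inl [simp]: "X0 lam $ Inl i = mmonom (axis i 1) (lam i)"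
  and X0_Inr [simp]: "X0 lam $ Inr j = 0"
  by (simp_all add: X0_def)

lemma x_part_Inl [simp]: "x_part U $ Inl i = U $ Inl i"
  and x_part_Inr [simp]: "x_part U $ Inr j = 0"
  by (simp_all add: x_part_def)

lemma mcoeff_vf_apply_X0:
  fixes h :: "('c::comm_ring_1, 'm::finite) mfps"
  shows "mcoeff (vf_apply C (X0 lam) h) \<alpha> = (\<Sum>l\<in>UNIV. of_nat (\<alpha> $ l) * lam l) * mcoeff h \<alpha>"
  by (simp add: vf_apply_def mcoeff_euler sum_distrib_right del: mcoeff_mpd One_nat_def)

lemma mpd_X0: "mpd l (mmonom (axis i 1) c) = (if l = i then mmonom 0 c else 0)"
  by (auto simp: mfps_eq_iff vec_eq_iff axis_def)

lemma vf_apply_x_part_X0: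
  fixes U :: "('c::comm_ring_1, 'm::finite, 'k::finite) xfield"
  shows "vf_apply C (x_part U) (X0 lam $ Inl i) = mmonom 0 (lam i) * U $ Inl i"
  by (simp add: vf_apply_def mpd_X0 if_distrib mult.commute del: One_nat_def cong: if_cong)

text \<open>
  The factor by which the homological operator multiplies $x^\alpha$ in the component \<open>c\<close>. Taking
  $\lambda$ with values in the coefficient ring gives the eigenvalue as a function of $u$; taking
  $\lambda(0)$ gives its value at $u = 0$, the number in the nonresonance condition.
\<close>

definition eigenvalue :: "('m \<Rightarrow> 'c::comm_ring_1) \<Rightarrow> 'm + 'k \<Rightarrow> nat ^ 'm::finite \<Rightarrow> 'c" where
  "eigenvalue lam c \<alpha> = (\<Sum>l\<in>UNIV. of_nat (\<alpha> $ l) * lam l) - (case c of Inl i \<Rightarrow> lam i | Inr j \<Rightarrow> 0)"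

section \<open>Coefficient rings\<close>

text \<open>
  What the normal form procedure uses of the coefficients: it divides by eigenvalues and otherwise only
  counts orders in $x$. Additivity of \<open>du\<close> is restricted to the coefficients, since partial
  derivatives of arbitrary germs are not additive.
\<close>

locale coefficient_ring =
  fixes C :: "('c::{comm_ring_1, real_algebra_1}, 'k::finite, 'a::real_normed_field) coeff_ring"
  assumes one_closed: "1 \<in> coeffs C"
    and add_closed: "x \<in> coeffs C \<Longrightarrow> y \<in> coeffs C \<Longrightarrow> x + y \<in> coeffs C"
    and mult_closed: "x \<in> coeffs C \<Longrightarrow> y \<in> coeffs C \<Longrightarrow> x * y \<in> coeffs C"
    and scaleR_closed: "x \<in> coeffs C \<Longrightarrow> r *\<^sub>R x \<in> coeffs C"
    and du_closed: "x \<in> coeffs C \<Longrightarrow> du C j x \<in> coeffs C"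
    and du_add: "x \<in> coeffs C \<Longrightarrow> y \<in> coeffs C \<Longrightarrow> du C j (x + y) = du C j x + du C j y"
    and at0_add: "x \<in> coeffs C \<Longrightarrow> y \<in> coeffs C \<Longrightarrow> at0 C (x + y) = at0 C x + at0 C y"
    and unit_if_at0_nonzero: "x \<in> coeffs C \<Longrightarrow> at0 C x \<noteq> 0 \<Longrightarrow> \<exists>y\<in>coeffs C. x * y = 1"
begin

lemma zero_closed: "0 \<in> coeffs C"
  using scaleR_closed[OF one_closed, of 0] by simp

lemma diff_closed: "x \<in> coeffs C \<Longrightarrow> y \<in> coeffs C \<Longrightarrow> x - y \<in> coeffs C"
  using add_closed[of x "-1 *\<^sub>R y"] scaleR_closed[of y "-1"] by simp

lemma sum_closed: "(\<And>i. i \<in> A \<Longrightarrow> f i \<in> coeffs C) \<Longrightarrow> (\<Sum>i\<in>A. f i) \<in> coeffs C"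
  by (induction A rule: infinite_finite_induct) (auto intro: zero_closed add_closed)

lemma of_nat_mult_closed: "x \<in> coeffs C \<Longrightarrow> of_nat n * x \<in> coeffs C"
  by (induction n) (auto simp: distrib_right intro: zero_closed add_closed)

lemma du_0 [simp]: "du C j 0 = 0"
  using du_add[OF zero_closed zero_closed, of j] by simp

lemma at0_0 [simp]: "at0 C 0 = 0"
  using at0_add[OF zero_closed zero_closed] by simp

lemma at0_diff: "x \<in> coeffs C \<Longrightarrow> y \<in> coeffs C \<Longrightarrow> at0 C (x - y) = at0 C x - at0 C y"
  using at0_add[of "x - y" y] diff_closed[of x y] by (simp add: algebra_simps)

lemma at0_sum:
  "(\<And>i. i \<in> A \<Longrightarrow> f i \<in> coeffs C) \<Longrightarrow> at0 C (\<Sum>i\<in>A. f i) = (\<Sum>i\<in>A. at0 C (f i))"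
  by (induction A rule: infinite_finite_induct) (auto simp: at0_add sum_closed)

lemma at0_of_nat_mult: "x \<in> coeffs C \<Longrightarrow> at0 C (of_nat n * x) = of_nat n * at0 C x"
  by (induction n) (auto simp: distrib_right at0_add of_nat_mult_closed)

lemma eigenvalue_closed: "(\<And>i. lam i \<in> coeffs C) \<Longrightarrow> eigenvalue lam c \<alpha> \<in> coeffs C"
  unfolding eigenvalue_def
  by (cases c) (auto intro!: diff_closed sum_closed of_nat_mult_closed zero_closed)

lemma at0_eigenvalue:
  assumes "\<And>i. lam i \<in> coeffs C"
  shows "at0 C (eigenvalue lam c \<alpha>) = eigenvalue (\<lambda>i. at0 C (lam i)) c \<alpha>"
  using assms unfolding eigenvalue_def
  by (cases c) (simp_all add: at0_diff at0_sum sum_closed of_nat_mult_closed zero_closed at0_of_nat_mult)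

section \<open>The homological operator is diagonal\<close>

text \<open>
  The subtracted term $U(X_0)$ contributes $-\lambda_i$ and involves no derivative of $\lambda_i$,
  because only the $\partial_x$ part of \<open>U\<close> enters it. The $\partial_u$ components have no
  counterpart, hence the missing $-\lambda_i$ there.
\<close>

lemma mcoeff_L_hat:
  fixes U :: "('c, 'm::finite, 'k) xfield"
  shows "mcoeff (L_hat C lam U $ c) \<alpha> = eigenvalue lam c \<alpha> * mcoeff (U $ c) \<alpha>"
proof (cases c)
  case (Inl i)
  show ?thesis
    using Inl by (simp add: L_hat_def bracket_def mcoeff_vf_apply_X0 vf_apply_x_part_X0 eigenvalue_def
        left_diff_distrib del: X0_Inl)
next
  case (Inr j)
  have "vf_apply C V 0 = 0" for V :: "('c, 'm, 'k) xfield"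
    by (simp add: vf_apply_def mfps_eq_iff mcoeff_mult)
  then show ?thesis
    using Inr by (simp add: L_hat_def bracket_def mcoeff_vf_apply_X0 eigenvalue_def)
qed

section \<open>Transformations generated by homogeneous fields\<close>

definition series_over :: "('c, 'm::finite) mfps \<Rightarrow> bool" where
  "series_over h \<longleftrightarrow> (\<forall>\<alpha>. mcoeff h \<alpha> \<in> coeffs C)"

definition field_over :: "('c, 'm::finite, 'k) xfield \<Rightarrow> bool" where
  "field_over X \<longleftrightarrow> (\<forall>c. series_over (X $ c))"

lemma series_over_diff: "series_over f \<Longrightarrow> series_over g \<Longrightarrow> series_over (f - g)"
  by (simp add: series_over_def diff_closed)

lemma series_over_vf_apply:
  assumes "field_over X" "series_over h"
  shows "series_over (vf_apply C X h)"
  using assms unfolding series_over_def field_over_def vf_apply_def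
  by (auto simp: mcoeff_mult case_prod_unfold simp del: of_nat_Suc of_nat_add
      intro!: add_closed sum_closed mult_closed[of "mcoeff _ _"] du_closed of_nat_mult_closed)

lemma field_over_bracket: "field_over X \<Longrightarrow> field_over Y \<Longrightarrow> field_over (bracket C X Y)"
  by (auto simp: field_over_def bracket_def intro!: series_over_diff series_over_vf_apply)

lemma vf_apply_add:
  assumes "series_over f" "series_over g"
  shows "vf_apply C X (f + g) = vf_apply C X f + vf_apply C X g"
proof -
  have "mmap (du C j) (f + g) = mmap (du C j) f + mmap (du C j) g" for j
    using assms by (simp add: mfps_eq_iff series_over_def du_add)
  then show ?thesis
    by (simp add: vf_apply_def mpd_add distrib_left sum.distrib)
qed

lemma bracket_add_right:
  assumes "field_over X" "field_over Y"
  shows "bracket C U (X + Y) = bracket C U X + bracket C U Y"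
proof -
  have "vf_apply C (X + Y) h = vf_apply C X h + vf_apply C Y h" for h
    by (simp add: vf_apply_def distrib_right sum.distrib)
  then show ?thesis
    using assms by (simp add: bracket_def vec_eq_iff vf_apply_add field_over_def)
qed

text \<open>
  Differentiation in $x$ costs one order and differentiation in $u$ costs none, so the worst terms are
  those with $\partial_x$.
\<close>

lemma order_ge_vf_apply:
  assumes "\<And>c. order_ge (Suc m) (X $ c)" "order_ge (Suc n) h"
  shows "order_ge (Suc (m + n)) (vf_apply C X h)"
proof -
  have "order_ge (Suc m + n) (X $ Inl i * mpd i h)" for i
    using assms by (intro order_ge_mult order_ge_mpd)
  moreover have "order_ge (Suc m + Suc n) (X $ Inr j * mmap (du C j) h)" for j
    using assms by (intro order_ge_mult) (auto simp: order_ge_def)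
  ultimately show ?thesis
    unfolding vf_apply_def by (intro order_ge_add order_ge_sum) (auto intro: order_ge_mono[of "Suc (Suc (m + n))"])
qed

lemma order_ge_bracket:
  assumes "\<And>c. order_ge (Suc m) (X $ c)" "\<And>c. order_ge (Suc n) (Y $ c)"
  shows "order_ge (Suc (m + n)) (bracket C X Y $ c)"
  using assms order_ge_vf_apply[of m X n "Y $ c"] order_ge_vf_apply[of n Y m "X $ c"]
  by (simp add: bracket_def order_ge_diff add.commute)

lemma order_ge_bracket_funpow:
  assumes "\<And>c. order_ge (Suc d) (U $ c)" "\<And>c. order_ge 1 (X $ c)"
  shows "order_ge (Suc (n * d)) ((bracket C U ^^ n) X $ c)"
  using assms(2) by (induction n arbitrary: c) (auto intro!: order_ge_bracket assms(1))

lemma field_over_bracket_funpow: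
  "field_over U \<Longrightarrow> field_over X \<Longrightarrow> field_over ((bracket C U ^^ n) X)"
  by (induction n) (auto intro: field_over_bracket)

text \<open>
  The $n$-th iterated bracket has order more than $n d$, so the exponential series for the coefficient
  of $x^\alpha$ breaks off as soon as $n d \ge |\alpha|$.
\<close>

lemma mcoeff_exp_ad:
  assumes U: "\<And>c. order_ge (Suc d) (U $ c)" and X: "\<And>c. order_ge 1 (X $ c)"
    and N: "mdeg \<alpha> \<le> N * d"
  shows "mcoeff (exp_ad C U X $ c) \<alpha> =
    (\<Sum>n<N. (1 / fact n) *\<^sub>R mcoeff ((bracket C U ^^ n) X $ c) \<alpha>)"
proof -
  have "mcoeff ((bracket C U ^^ n) X $ c) \<alpha> = 0" if "n \<ge> N" for n
  proof (rule order_geD[OF order_ge_bracket_funpow[OF U X]])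
    have "N * d \<le> n * d" using that by simp
    then show "mdeg \<alpha> < Suc (n * d)" using N by linarith
  qed
  then have "{n. (1 / fact n) *\<^sub>R mcoeff ((bracket C U ^^ n) X $ c) \<alpha> \<noteq> 0} \<subseteq> {..<N}"
    by (auto simp: not_le[symmetric])
  then show ?thesis
    by (simp add: exp_ad_def Sum_any.expand_superset[of "{..<N}"])
qed

lemma field_over_exp_ad:
  assumes "\<And>c. order_ge (Suc d) (U $ c)" "\<And>c. order_ge 1 (X $ c)" "d \<ge> 1"
    and "field_over U" "field_over X"
  shows "field_over (exp_ad C U X)"
  unfolding field_over_def series_over_def
proof (intro allI)
  fix c and \<alpha> :: "nat ^ 'b"
  have "mdeg \<alpha> \<le> mdeg \<alpha> * d" using assms(3) by simp
  then show "mcoeff (exp_ad C U X $ c) \<alpha> \<in> coeffs C"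
    using field_over_bracket_funpow[OF assms(4,5)]
    by (auto simp: mcoeff_exp_ad[OF assms(1,2), where N = "mdeg \<alpha>"] field_over_def series_over_def
        intro!: sum_closed scaleR_closed)
qed

lemma mcoeff_exp_ad_low:
  assumes "\<And>c. order_ge (Suc d) (U $ c)" "\<And>c. order_ge 1 (X $ c)" "mdeg \<alpha> \<le> d"
  shows "mcoeff (exp_ad C U X $ c) \<alpha> = mcoeff (X $ c) \<alpha>"
  using assms by (subst mcoeff_exp_ad[where N = 1 and d = d]) auto

lemma pre_normal_form_D:
  fixes X :: "('c, 'm::finite, 'k) xfield"
  assumes "pre_normal_form lam X"
  shows "order_ge 1 (X $ c)" and "order_ge 2 ((X - X0 lam) $ c)"
    and "lam i = mcoeff (X $ Inl i) (axis i 1)"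
proof -
  have 0: "mcoeff (X $ c) 0 = 0" for c
    using assms by (simp add: pre_normal_form_def)
  have 1: "mcoeff (X $ c) \<alpha> = mcoeff (X0 lam $ c) \<alpha>" if "mdeg \<alpha> = 1" for c \<alpha>
  proof -
    have "mcoeff (homogeneous_part 0 X $ c) \<alpha> = mcoeff (X0 lam $ c) \<alpha>"
      using assms by (simp add: pre_normal_form_def)
    then show ?thesis using that by (simp add: homogeneous_part_def)
  qed
  show "order_ge 1 (X $ c)"
    using 0 by (simp add: order_ge_def)
  have "mcoeff (X0 lam $ c) 0 = 0" for c :: "'m + 'k"
    by (cases c) (auto simp: vec_eq_iff axis_def)
  then show "order_ge 2 ((X - X0 lam) $ c)"
    using 0 1 by (auto simp: order_ge_def less_2_cases_iff)
  show "lam i = mcoeff (X $ Inl i) (axis i 1)"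
    by (simp add: 1)
qed

text \<open>
  The bracket with $X_0$ and the homological operator differ only by the derivatives of the $\lambda_i$
  along the $\partial_u$ part of \<open>U\<close>. Each of these carries the factor $x_i$ from $X_0$ and
  therefore has degree at least $d + 1$.
\<close>

lemma mcoeff_bracket_X0:
  fixes U :: "('c, 'm::finite, 'k) xfield"
  assumes "\<And>c. order_ge (Suc d) (U $ c)" "mdeg \<alpha> = Suc d"
  shows "mcoeff (bracket C U (X0 lam) $ c) \<alpha> = - mcoeff (L_hat C lam U $ c) \<alpha>"
proof (cases c)
  case (Inl i)
  have "order_ge (Suc d + 1) (U $ Inr j * mmap (du C j) (X0 lam $ Inl i))" for j
    using assms by (intro order_ge_mult) (auto simp: order_ge_def vec_eq_iff axis_def)
  then have "order_ge (Suc d + 1) (\<Sum>j\<in>UNIV. U $ Inr j * mmap (du C j) (X0 lam $ Inl i))"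
    by (intro order_ge_sum)
  then have 1: "mcoeff (\<Sum>j\<in>UNIV. U $ Inr j * mmap (du C j) (X0 lam $ Inl i)) \<alpha> = 0"
    by (rule order_geD) (use assms in simp)
  have "vf_apply C U (X0 lam $ Inl i) = vf_apply C (x_part U) (X0 lam $ Inl i) +
      (\<Sum>j\<in>UNIV. U $ Inr j * mmap (du C j) (X0 lam $ Inl i))"
    by (simp add: vf_apply_def)
  then have "mcoeff (vf_apply C U (X0 lam $ Inl i)) \<alpha> =
      mcoeff (vf_apply C (x_part U) (X0 lam $ Inl i)) \<alpha>"
    using 1 by simp
  then show ?thesis
    using Inl by (simp add: L_hat_def bracket_def del: X0_Inl)
next
  case (Inr j)
  have "vf_apply C V 0 = 0" for V :: "('c, 'm, 'k) xfield"
    by (simp add: vf_apply_def mfps_eq_iff mcoeff_mult)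
  then show ?thesis
    using Inr by (simp add: L_hat_def bracket_def)
qed

lemma field_over_X0: "(\<And>i. lam i \<in> coeffs C) \<Longrightarrow> field_over (X0 lam :: ('c, 'm::finite, 'k) xfield)"
proof -
  assume "\<And>i. lam i \<in> coeffs C"
  then have "series_over (X0 lam $ c)" for c :: "'m + 'k"
    by (cases c) (auto simp: series_over_def zero_closed)
  then show ?thesis by (simp add: field_over_def)
qed

lemma pre_normal_form_lam_closed:
  assumes "pre_normal_form lam X" "field_over X"
  shows "\<And>i. lam i \<in> coeffs C"
  using assms pre_normal_form_D(3)[of lam X] by (simp add: field_over_def series_over_def)

text \<open>
  Among the brackets $[U, X_e]$ only the one with $e = 0$ reaches degree $d$, and the higher iterated
  brackets start beyond it since $d \ge 1$.
\<close>

lemma mcoeff_exp_ad_leading: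
  assumes d: "d \<ge> 1" and U: "\<And>c. order_ge (Suc d) (U $ c)"
    and X: "pre_normal_form lam X" "field_over X" and \<alpha>: "mdeg \<alpha> = Suc d"
  shows "mcoeff (exp_ad C U X $ c) \<alpha> = mcoeff (X $ c) \<alpha> - mcoeff (L_hat C lam U $ c) \<alpha>"
proof -
  note lam = pre_normal_form_lam_closed[OF X]
  \<comment> \<open>Brackets with the remainder \<open>R\<close> have degree more than \<open>d\<close>.\<close>
  define R where "R = X - X0 lam"
  have R: "field_over R" "X = X0 lam + R" "\<And>c. order_ge (Suc 1) (R $ c)"
    using X field_over_X0[of lam, OF lam] pre_normal_form_D(2)[OF X(1)]
    by (auto simp: R_def field_over_def numeral_2_eq_2 intro!: series_over_diff)
  have "mcoeff (bracket C U R $ c) \<alpha> = 0"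
    by (rule order_geD[OF order_ge_bracket[OF U R(3)]]) (use \<alpha> in simp)
  then have "mcoeff (bracket C U X $ c) \<alpha> = - mcoeff (L_hat C lam U $ c) \<alpha>"
    using mcoeff_bracket_X0[OF U \<alpha>]
    unfolding R(2) bracket_add_right[OF field_over_X0[of lam, OF lam] R(1)] by simp
  moreover have "mcoeff (exp_ad C U X $ c) \<alpha> =
    (\<Sum>n<2. (1 / fact n) *\<^sub>R mcoeff ((bracket C U ^^ n) X $ c) \<alpha>)"
    using U pre_normal_form_D(1)[OF X(1)] by (rule mcoeff_exp_ad) (use \<alpha> d in simp)
  ultimately show ?thesis by (simp add: numeral_2_eq_2)
qed

section \<open>The normal form inside a coefficient ring\<close>

lemma homogeneous_fields_D:
  assumes "U \<in> homogeneous_fields C d"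
  shows "order_ge (Suc d) (U $ c)" "field_over U"
  using assms by (auto simp: homogeneous_fields_def order_ge_def field_over_def series_over_def)

lemma homogeneous_part_in: "field_over X \<Longrightarrow> homogeneous_part d X \<in> homogeneous_fields C d"
  by (auto simp: homogeneous_fields_def homogeneous_part_def field_over_def series_over_def zero_closed)

lemma no_nonresonant_terms_iff_eigenvalue:
  fixes X :: "('c, 'm::finite, 'k) xfield"
  assumes "\<And>i. lam i \<in> coeffs C"
  shows "no_nonresonant_terms C lam X \<longleftrightarrow>
    (\<forall>c \<alpha>. mdeg \<alpha> \<ge> 2 \<longrightarrow> at0 C (eigenvalue lam c \<alpha>) \<noteq> 0 \<longrightarrow> mcoeff (X $ c) \<alpha> = 0)"
  unfolding no_nonresonant_terms_def at0_eigenvalue[OF assms]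
  by (auto simp: eigenvalue_def split_sum_all)

text \<open>
  Solving $\hat L(U) = $ (nonresonant part of \<open>V\<close>) termwise: a nonresonant eigenvalue does not
  vanish at $u = 0$, so it is a unit of the coefficient ring and one can divide by it.
\<close>

lemma remove_nonresonant_homogeneous:
  fixes V :: "('c, 'm::finite, 'k) xfield"
  assumes lam: "\<And>i. lam i \<in> coeffs C" and V: "V \<in> homogeneous_fields C d"
  obtains W where "W \<in> homogeneous_fields C d" "no_nonresonant_terms C lam W"
    "V - W \<in> L_hat C lam ` homogeneous_fields C d"
proof -
  obtain inv where inv: "\<And>x. x \<in> coeffs C \<Longrightarrow> at0 C x \<noteq> 0 \<Longrightarrow> inv x \<in> coeffs C \<and> x * inv x = 1"
    using unit_if_at0_nonzero by metis
  define nr where "nr c \<alpha> \<longleftrightarrow> at0 C (eigenvalue lam c \<alpha>) \<noteq> 0" for c :: "'m + 'k" and \<alpha>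
  define U :: "('c, 'm, 'k) xfield" where "U = (\<chi> c. Abs_mfps (\<lambda>\<alpha>.
    if nr c \<alpha> then inv (eigenvalue lam c \<alpha>) * mcoeff (V $ c) \<alpha> else 0))"
  define W :: "('c, 'm, 'k) xfield" where
    "W = (\<chi> c. Abs_mfps (\<lambda>\<alpha>. if nr c \<alpha> then 0 else mcoeff (V $ c) \<alpha>))"
  have inv': "inv (eigenvalue lam c \<alpha>) \<in> coeffs C \<and> eigenvalue lam c \<alpha> * inv (eigenvalue lam c \<alpha>) = 1"
    if "nr c \<alpha>" for c and \<alpha> :: "nat ^ 'm"
    using that unfolding nr_def by (intro inv eigenvalue_closed lam)
  show ?thesis
  proof
    show "W \<in> homogeneous_fields C d"
      using V by (auto simp: W_def homogeneous_fields_def zero_closed)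
    show "no_nonresonant_terms C lam W"
      by (auto simp: no_nonresonant_terms_iff_eigenvalue[of lam, OF lam] W_def nr_def)
    have "U \<in> homogeneous_fields C d"
      using V inv' by (auto simp: U_def homogeneous_fields_def zero_closed intro!: mult_closed)
    moreover have "V - W = L_hat C lam U"
      using inv' by (auto simp: vec_eq_iff mfps_eq_iff mcoeff_L_hat U_def W_def mult.assoc[symmetric])
    ultimately show "V - W \<in> L_hat C lam ` homogeneous_fields C d" by simp
  qed
qed

lemma ex_nonresonant_style:
  assumes lam: "\<And>i. lam i \<in> coeffs C"
  shows "\<exists>rep :: nat \<Rightarrow> ('c, 'm::finite, 'k) xfield set \<Rightarrow> ('c, 'm, 'k) xfield.
    normal_form_style C lam rep \<and>
    (\<forall>d\<ge>1. \<forall>K\<in>coker C lam d. no_nonresonant_terms C lam (rep d K))"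
proof -
  have "\<exists>W\<in>K. no_nonresonant_terms C lam W"
    if K_in: "K \<in> coker C lam d" for d and K :: "('c, 'm, 'k) xfield set"
  proof -
    obtain V where V: "V \<in> homogeneous_fields C d"
      and K: "K = {(V, W). V \<in> homogeneous_fields C d \<and> W \<in> homogeneous_fields C d \<and>
        V - W \<in> L_hat C lam ` homogeneous_fields C d} `` {V}"
      using K_in unfolding coker_def by (rule quotientE) blast
    obtain W where "W \<in> homogeneous_fields C d" "no_nonresonant_terms C lam W"
      "V - W \<in> L_hat C lam ` homogeneous_fields C d"
      by (rule remove_nonresonant_homogeneous[where lam = lam, OF lam V])
    then show ?thesis unfolding K using V by auto
  qed
  then show ?thesis
    unfolding normal_form_style_def
    by (intro exI[of _ "\<lambda>d K. SOME W. W \<in> K \<and> no_nonresonant_terms C lam W"])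
      (metis (mono_tags, lifting) someI_ex)
qed

text \<open>
  The representative of the class of $X_d$ differs from $X_d$ by some $\hat L_d(U)$; the transformation
  generated by this \<open>U\<close> replaces the one by the other.
\<close>

lemma normalizing_step:
  assumes rep: "normal_form_style C lam rep" and d: "d \<ge> 1"
    and X: "pre_normal_form lam X" "field_over X"
  shows "\<exists>U\<in>homogeneous_fields C d. pre_normal_form lam (exp_ad C U X) \<and> field_over (exp_ad C U X) \<and>
    (\<forall>c \<alpha>. mdeg \<alpha> \<le> d \<longrightarrow> mcoeff (exp_ad C U X $ c) \<alpha> = mcoeff (X $ c) \<alpha>) \<and>
    homogeneous_part d (exp_ad C U X) \<in> rep d ` coker C lam d"
proof -
  define R where "R = {(V, W). V \<in> homogeneous_fields C d \<and> W \<in> homogeneous_fields C d \<and>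
        V - W \<in> L_hat C lam ` homogeneous_fields C d}"
  define V where "V = homogeneous_part d X"
  have V: "V \<in> homogeneous_fields C d"
    unfolding V_def by (rule homogeneous_part_in) fact
  have K: "R `` {V} \<in> coker C lam d"
    unfolding coker_def R_def by (rule quotientI) fact
  then have "rep d (R `` {V}) \<in> R `` {V}"
    using rep d unfolding normal_form_style_def by blast
  then obtain U where U: "U \<in> homogeneous_fields C d" "V - rep d (R `` {V}) = L_hat C lam U"
    and rep': "rep d (R `` {V}) \<in> homogeneous_fields C d"
    by (auto simp: R_def)
  note U' = homogeneous_fields_D[OF U(1)] and X' = pre_normal_form_D(1)[OF X(1)]
  have low: "mcoeff (exp_ad C U X $ c) \<alpha> = mcoeff (X $ c) \<alpha>" if "mdeg \<alpha> \<le> d" for c \<alpha>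
    using U'(1) X' that by (rule mcoeff_exp_ad_low)
  have "homogeneous_part 0 (exp_ad C U X) = homogeneous_part 0 X"
    using low d by (simp add: homogeneous_part_def vec_eq_iff mfps_eq_iff)
  then have "pre_normal_form lam (exp_ad C U X)"
    using X low by (simp add: pre_normal_form_def)
  moreover have "field_over (exp_ad C U X)"
    using U'(1) X' d U'(2) X(2) by (rule field_over_exp_ad)
  moreover have "homogeneous_part d (exp_ad C U X) = rep d (R `` {V})"
  proof -
    have "mcoeff (exp_ad C U X $ c) \<alpha> = mcoeff (rep d (R `` {V}) $ c) \<alpha>" if \<alpha>: "mdeg \<alpha> = Suc d" for c \<alpha>
    proof -
      have "mcoeff (exp_ad C U X $ c) \<alpha> = mcoeff (V $ c) \<alpha> - mcoeff (L_hat C lam U $ c) \<alpha>"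
        using mcoeff_exp_ad_leading[OF d U'(1) X \<alpha>] \<alpha> by (simp add: V_def homogeneous_part_def)
      then show ?thesis by (simp add: U(2)[symmetric])
    qed
    then show ?thesis
      using rep' by (auto simp: homogeneous_part_def vec_eq_iff mfps_eq_iff homogeneous_fields_def)
  qed
  ultimately show ?thesis using U(1) low K by (intro bexI[of _ U]) auto
qed

text \<open>
  Iterating the normalizing step. The generator in degree $d$ depends on the field obtained so far, so
  the sequence of fields is defined first and the generators are read off from it.
\<close>

lemma ex_normal_form:
  assumes rep: "normal_form_style C lam rep" and X: "pre_normal_form lam X" "field_over X"
  shows "\<exists>Y. formally_conjugate C X Y \<and> normal_form C lam rep Y"
proof -
  define good where "good Z \<longleftrightarrow> pre_normal_form lam Z \<and> field_over Z" for Z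
  \<comment> \<open>\<open>u d Z\<close> is a generator of degree \<open>d\<close> that normalizes degree \<open>d\<close> of \<open>Z\<close>.\<close>
  obtain u where u: "\<And>d Z. d \<ge> 1 \<Longrightarrow> good Z \<Longrightarrow> u d Z \<in> homogeneous_fields C d \<and>
    good (exp_ad C (u d Z) Z) \<and>
    (\<forall>c \<alpha>. mdeg \<alpha> \<le> d \<longrightarrow> mcoeff (exp_ad C (u d Z) Z $ c) \<alpha> = mcoeff (Z $ c) \<alpha>) \<and>
    homogeneous_part d (exp_ad C (u d Z) Z) \<in> rep d ` coker C lam d"
    using normalizing_step[OF rep] unfolding good_def by metis
  define Z where "Z = rec_nat X (\<lambda>d Z. exp_ad C (u (Suc d) Z) Z)"
  define U where "U d = u d (Z (d - 1))" for d
  have Z_Suc: "Z (Suc d) = exp_ad C (u (Suc d) (Z d)) (Z d)" for d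
    by (simp add: Z_def)
  have good: "good (Z d)" for d
    by (induction d) (use X u in \<open>auto simp: Z_Suc good_def[of X] Z_def\<close>)
  have U: "transformed C U X d = Z d" for d
    by (induction d) (auto simp: U_def Z_Suc, simp add: Z_def)
  have step: "mcoeff (Z (Suc d) $ c) \<alpha> = mcoeff (Z d $ c) \<alpha>" if "mdeg \<alpha> \<le> Suc d" for c \<alpha> d
    using u[of "Suc d" "Z d"] good[of d] that by (simp add: Z_Suc)
  have stable: "mcoeff (Z e $ c) \<alpha> = mcoeff (Z d $ c) \<alpha>" if "mdeg \<alpha> \<le> Suc d" "d \<le> e" for c \<alpha> d e
    using that(2) by (induction e rule: dec_induct) (use step that(1) in auto)
  \<comment> \<open>Stage $|\alpha|$ is late enough: from stage $|\alpha| - 1$ on the coefficient of $x^\alpha$ is constant.\<close>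
  define Y where "Y = (\<chi> c. Abs_mfps (\<lambda>\<alpha>. mcoeff (Z (mdeg \<alpha>) $ c) \<alpha>))"
  have Y: "mcoeff (Y $ c) \<alpha> = mcoeff (Z d $ c) \<alpha>" if "mdeg \<alpha> \<le> Suc d" for c \<alpha> d
    using stable[of \<alpha> d "mdeg \<alpha>"] stable[of \<alpha> "mdeg \<alpha>" d] that
    by (cases "d \<le> mdeg \<alpha>") (auto simp: Y_def)
  have hom: "homogeneous_part d Y = homogeneous_part d (Z d)" for d
    by (simp add: homogeneous_part_def vec_eq_iff mfps_eq_iff Y)
  show ?thesis
  proof (intro exI conjI)
    show "formally_conjugate C X Y"
      unfolding formally_conjugate_def
    proof (intro exI[of _ U] conjI allI impI)
      show "U d \<in> homogeneous_fields C d" if "d \<ge> 1" for d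
        using u[OF that good] by (simp add: U_def)
      show "\<forall>\<^sub>F d in sequentially. mcoeff (transformed C U X d $ c) \<alpha> = mcoeff (Y $ c) \<alpha>" for c \<alpha>
        using eventually_ge_at_top[of "mdeg \<alpha>"] by eventually_elim (simp add: U Y[OF le_SucI])
    qed
    show "normal_form C lam rep Y"
      unfolding normal_form_def pre_normal_form_def
    proof (intro conjI allI impI)
      show "mcoeff (Y $ c) 0 = 0" for c
        using X by (simp add: Y[of _ 0] pre_normal_form_def Z_def)
      show "homogeneous_part 0 Y = X0 lam"
        using X by (simp add: hom pre_normal_form_def Z_def)
      show "homogeneous_part d Y \<in> rep d ` coker C lam d" if "d \<ge> 1" for d
        using u[OF that good[of "d - 1"]] that Z_Suc[of "d - 1"] by (simp add: hom)
    qed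
  qed
qed

text \<open>
  A style whose representatives contain no nonresonant terms gives a normal form without them, because
  the absence of such terms can be tested degree by degree.
\<close>

theorem nonresonant_terms_removable_if_over:
  fixes X :: "('c, 'm::finite, 'k) xfield"
  assumes X: "pre_normal_form lam X" "\<And>c \<alpha>. mcoeff (X $ c) \<alpha> \<in> coeffs C"
  shows "nonresonant_terms_removable C lam X"
proof -
  have series_over: "field_over X"
    using X(2) by (simp add: field_over_def series_over_def)
  note lam = pre_normal_form_lam_closed[OF X(1) series_over]
  obtain rep :: "nat \<Rightarrow> ('c, 'm, 'k) xfield set \<Rightarrow> ('c, 'm, 'k) xfield"
    where rep: "normal_form_style C lam rep"
    "\<forall>d\<ge>1. \<forall>K\<in>coker C lam d. no_nonresonant_terms C lam (rep d K)"
    using ex_nonresonant_style[of lam, OF lam] by blast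
  obtain Y where Y: "formally_conjugate C X Y" "normal_form C lam rep Y"
    using ex_normal_form[OF rep(1) X(1) series_over] by blast
  have "no_nonresonant_terms C lam Y"
    unfolding no_nonresonant_terms_iff_eigenvalue[of lam, OF lam]
  proof (intro allI impI)
    fix c :: "'m + 'k" and \<alpha> :: "nat ^ 'm"
    assume \<alpha>: "2 \<le> mdeg \<alpha>" "at0 C (eigenvalue lam c \<alpha>) \<noteq> 0"
    define d where "d = mdeg \<alpha> - 1"
    have d: "d \<ge> 1" "mdeg \<alpha> = d + 1" using \<alpha> by (auto simp: d_def)
    then have "no_nonresonant_terms C lam (homogeneous_part d Y)"
      using Y(2) rep(2) by (auto simp: normal_form_def)
    then have "mcoeff (homogeneous_part d Y $ c) \<alpha> = 0"
      using \<alpha> unfolding no_nonresonant_terms_iff_eigenvalue[of lam, OF lam] by blast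
    then show "mcoeff (Y $ c) \<alpha> = 0"
      using d by (simp add: homogeneous_part_def)
  qed
  then show ?thesis
    using rep Y unfolding nonresonant_terms_removable_def by blast
qed

end

section \<open>Formal power series as coefficients\<close>

lemma order_ge_power:
  fixes q :: "('c::comm_ring_1, 'm::finite) mfps"
  assumes "order_ge 1 q"
  shows "order_ge n (q ^ n)"
proof (induction n)
  case 0
  then show ?case by (simp add: order_ge_def)
next
  case (Suc n)
  then show ?case using order_ge_mult[OF assms Suc] by simp
qed

text \<open>
  The inverse is $\sum_n q^n$. It makes sense because $q^n$ has order at least $n$, so the coefficient
  of $x^\alpha$ is a finite sum over $n \le |\alpha|$.
\<close>

lemma geometric_series:
  fixes q :: "('c::comm_ring_1, 'm::finite) mfps"
  assumes q: "order_ge 1 q"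
  shows "\<exists>g. (1 - q) * g = 1"
proof -
  define g where "g = Abs_mfps (\<lambda>\<alpha>. \<Sum>n\<le>mdeg \<alpha>. mcoeff (q ^ n) \<alpha>)"
  have "mcoeff ((1 - q) * g) \<gamma> = mcoeff 1 \<gamma>" for \<gamma>
  proof -
    define N where "N = mdeg \<gamma>"
    \<comment> \<open>Up to degree \<open>N\<close> the series agrees with this partial sum, for which the finite formula holds.\<close>
    define S where "S = (\<Sum>n\<le>N. q ^ n)"
    have "order_ge (Suc N) (g - S)"
      unfolding order_ge_def
    proof (intro allI impI)
      fix \<alpha> :: "nat ^ 'm" assume "mdeg \<alpha> < Suc N"
      then have "(\<Sum>n\<le>mdeg \<alpha>. mcoeff (q ^ n) \<alpha>) = (\<Sum>n\<le>N. mcoeff (q ^ n) \<alpha>)"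
        by (intro sum.mono_neutral_left) (auto intro: order_geD[OF order_ge_power[OF q]])
      then show "mcoeff (g - S) \<alpha> = 0" by (simp add: g_def S_def)
    qed
    then have "order_ge (0 + Suc N) ((1 - q) * (g - S))"
      by (intro order_ge_mult) (simp add: order_ge_def)
    then have "mcoeff ((1 - q) * (g - S)) \<gamma> = 0"
      by (rule order_geD) (simp add: N_def)
    moreover have "(1 - q) * g = (1 - q ^ Suc N) + (1 - q) * (g - S)"
      using sum_gp_basic[of q N] by (simp add: S_def algebra_simps)
    moreover have "mcoeff (q ^ Suc N) \<gamma> = 0"
      by (rule order_geD[OF order_ge_power[OF q]]) (simp add: N_def)
    ultimately show ?thesis by simp
  qed
  then have "(1 - q) * g = 1" unfolding mfps_eq_iff by blast
  then show ?thesis by blast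
qed

text \<open>
  Dividing by the constant coefficient puts a series into the form $1 - q$, to which the geometric
  series applies.
\<close>

lemma order_ge_one_minus_normalized:
  fixes p :: "('c::field, 'm::finite) mfps"
  assumes "mcoeff p 0 \<noteq> 0"
  shows "order_ge 1 (1 - mmonom 0 (inverse (mcoeff p 0)) * p)"
  using assms by (simp add: order_ge_def)

lemma coefficient_ring_formal:
  "coefficient_ring (formal_ring :: (('a::real_normed_field, 'k::finite) mfps, 'k, 'a) coeff_ring)"
proof
  fix p :: "('a, 'k) mfps"
  assume "at0 formal_ring p \<noteq> 0"
  then have "mcoeff p 0 \<noteq> 0" by (simp add: formal_ring_def)
  from geometric_series[OF order_ge_one_minus_normalized[OF this]]
  obtain g where "mmonom 0 (inverse (mcoeff p 0)) * p * g = 1" by auto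
  then have "p * (mmonom 0 (inverse (mcoeff p 0)) * g) = 1" by (simp add: algebra_simps)
  then show "\<exists>b\<in>coeffs formal_ring. p * b = 1" by (auto simp: formal_ring_def)
qed (simp_all add: formal_ring_def mpd_add)

section \<open>Germs and partial derivatives\<close>

lemma germ_of_eq_iff: "germ_of f = germ_of g \<longleftrightarrow> (\<forall>\<^sub>F u in nhds 0. f u = g u)"
  by (rule germ.abs_eq_iff)

lemma germ_of_eqI:
  assumes "open S" "0 \<in> S" "\<And>u. u \<in> S \<Longrightarrow> f u = g u"
  shows "germ_of f = germ_of g"
  unfolding germ_of_eq_iff eventually_nhds using assms by blast

lemma eventually_axis_in:
  fixes u :: "'a::real_normed_field ^ 'n::finite"
  assumes "open S" "u \<in> S"
  shows "\<forall>\<^sub>F t in nhds 0. u + axis j t \<in> S"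
  by (rule topological_tendstoD[OF tendsto_add_axis assms])

lemma pd_cong_on:
  assumes "open S" "u \<in> S" "\<And>v. v \<in> S \<Longrightarrow> f v = g v"
  shows "pd j f u = pd j g u"
proof -
  have "\<forall>\<^sub>F v in nhds u. f v = g v"
    unfolding eventually_nhds using assms by blast
  then show ?thesis by (rule eventually_nhds_x_imp_x[OF pd_cong_eventually])
qed

definition has_pd :: "'n::finite \<Rightarrow> ('a::real_normed_field ^ 'n \<Rightarrow> 'a) \<Rightarrow> 'a ^ 'n \<Rightarrow> bool" where
  "has_pd j f u \<longleftrightarrow> (\<lambda>t. f (u + axis j t)) field_differentiable (at 0)"

lemma has_pd_iff: "has_pd j f u \<longleftrightarrow> ((\<lambda>t. f (u + axis j t)) has_field_derivative pd j f u) (at 0)"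
  unfolding has_pd_def pd_def by (simp add: DERIV_deriv_iff_field_differentiable)

lemma axis_0 [simp]: "axis j 0 = 0"
  by (simp add: vec_eq_iff axis_def)

lemma has_field_derivative_imp_pd:
  "((\<lambda>t. f (u + axis j t)) has_field_derivative D) (at 0) \<Longrightarrow> has_pd j f u \<and> pd j f u = D"
  unfolding has_pd_def pd_def by (metis DERIV_imp_deriv field_differentiable_def)

lemma pd_const: "has_pd j (\<lambda>_. c) u \<and> pd j (\<lambda>_. c) u = 0"
  by (rule has_field_derivative_imp_pd) simp

lemma pd_add:
  assumes "has_pd j f u" "has_pd j g u"
  shows "has_pd j (\<lambda>u. f u + g u) u \<and> pd j (\<lambda>u. f u + g u) u = pd j f u + pd j g u"
  using assms unfolding has_pd_iff[of j f] has_pd_iff[of j g]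
  by (intro has_field_derivative_imp_pd DERIV_add)

lemma pd_mult:
  assumes "has_pd j f u" "has_pd j g u"
  shows "has_pd j (\<lambda>u. f u * g u) u \<and> pd j (\<lambda>u. f u * g u) u = pd j f u * g u + pd j g u * f u"
  using DERIV_mult[OF assms[unfolded has_pd_iff]]
  by (intro has_field_derivative_imp_pd) simp

lemma pd_inverse:
  assumes "has_pd j f u" "f u \<noteq> 0"
  shows "has_pd j (\<lambda>u. inverse (f u)) u \<and> pd j (\<lambda>u. inverse (f u)) u = - 1 * (pd j f u * (inverse (f u) * inverse (f u)))"
  using DERIV_inverse_fun[OF assms(1)[unfolded has_pd_iff]] assms(2)
  by (intro has_field_derivative_imp_pd) (simp add: power2_eq_square inverse_mult_distrib)

lemma has_pd_cong_on:
  assumes "open S" "u \<in> S" "\<And>v. v \<in> S \<Longrightarrow> f v = g v" "has_pd j f u"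
  shows "has_pd j g u"
proof -
  have "\<forall>\<^sub>F t in nhds 0. f (u + axis j t) = g (u + axis j t)"
    using eventually_axis_in[OF assms(1,2)] by eventually_elim (rule assms(3))
  then show ?thesis
    using assms(4) unfolding has_pd_def field_differentiable_def by (simp cong: DERIV_cong_ev)
qed

text \<open>
  The expansion in $x$ of a germ is built from it by partial derivatives, restriction to $x = 0$ and
  scaling, whatever order of differentiation is chosen.
\<close>

lemma mcoeff_germ_expansion_in:
  fixes G :: "('a::real_normed_field, 'm::finite + 'k::finite) germ ^ ('m + 'k)"
    and A :: "('a, 'm + 'k) germ set" and B :: "('a, 'k) germ set"
  assumes "\<And>j F. F \<in> A \<Longrightarrow> germ_pd j F \<in> A" "\<And>F. F \<in> A \<Longrightarrow> germ_restrict F \<in> B"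
    and "\<And>r f. f \<in> B \<Longrightarrow> r *\<^sub>R f \<in> B" "G $ c \<in> A"
  shows "mcoeff (germ_expansion G $ c) \<alpha> \<in> B"
proof -
  have "foldr germ_pd js (G $ c) \<in> A" for js
    by (induction js) (use assms in auto)
  then show ?thesis
    using assms by (simp add: germ_expansion_def germ_dx_def Let_def)
qed

section \<open>Smooth germs as coefficients\<close>

text \<open>
  The functions obtained on \<open>S\<close> from smooth ones and constants by sums, products and
  reciprocals. The iterated partial derivatives of a product or reciprocal have no convenient closed form, but they all stay in
  this set; so membership in it is an invariant of differentiation and implies smoothness.
\<close>

inductive_set smooth_closure :: "('a::real_normed_field ^ 'n::finite) set \<Rightarrow> ('a ^ 'n \<Rightarrow> 'a) set"
  for S where
  base: "smooth_on_nbhd S f \<Longrightarrow> f \<in> smooth_closure S"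
| const: "(\<lambda>_. c) \<in> smooth_closure S"
| add: "f \<in> smooth_closure S \<Longrightarrow> g \<in> smooth_closure S \<Longrightarrow> (\<lambda>u. f u + g u) \<in> smooth_closure S"
| mult: "f \<in> smooth_closure S \<Longrightarrow> g \<in> smooth_closure S \<Longrightarrow> (\<lambda>u. f u * g u) \<in> smooth_closure S"
| inverse: "f \<in> smooth_closure S \<Longrightarrow> (\<forall>u\<in>S. f u \<noteq> 0) \<Longrightarrow> (\<lambda>u. inverse (f u)) \<in> smooth_closure S"
| cong: "f \<in> smooth_closure S \<Longrightarrow> (\<forall>u\<in>S. f u = g u) \<Longrightarrow> g \<in> smooth_closure S"

lemma smooth_on_nbhd_pd: "smooth_on_nbhd S f \<Longrightarrow> smooth_on_nbhd S (pd j f)"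
  unfolding smooth_on_nbhd_def
proof (intro allI)
  fix js
  assume *: "\<forall>js. continuous_on S (foldr pd js f) \<and>
    (\<forall>j. \<forall>u\<in>S. (\<lambda>t. foldr pd js f (u + axis j t)) field_differentiable at 0)"
  show "continuous_on S (foldr pd js (pd j f)) \<and>
    (\<forall>ja. \<forall>u\<in>S. (\<lambda>t. foldr pd js (pd j f) (u + axis ja t)) field_differentiable at 0)"
    using spec[OF *, of "js @ [j]"] by simp
qed

text \<open>
  The derivative rules express \<open>pd j f\<close> through members of the closure. They hold only at points of
  \<open>S\<close>, which is why the closure contains a rule for functions that agree on \<open>S\<close>.
\<close>

lemma smooth_closure_step:
  assumes S: "open S" and f: "f \<in> smooth_closure S"
  shows "continuous_on S f \<and> (\<forall>j. \<forall>u\<in>S. has_pd j f u) \<and> (\<forall>j. pd j f \<in> smooth_closure S)"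
  using f
proof induction
  case (base f)
  have "continuous_on S (foldr pd [] f)" "\<forall>j. \<forall>u\<in>S. has_pd j (foldr pd [] f) u"
    using base unfolding smooth_on_nbhd_def has_pd_def by blast+
  then show ?case using smooth_on_nbhd_pd[OF base] by (auto intro: smooth_closure.base)
next
  case (const c)
  have "pd j (\<lambda>_. c) = (\<lambda>_. 0)" for j :: 'b using pd_const by blast
  then show ?case using pd_const by (auto intro: smooth_closure.const)
next
  case (add f g)
  have *: "(\<lambda>u. pd j f u + pd j g u) \<in> smooth_closure S" for j
    using add by (intro smooth_closure.add) auto
  have "pd j (\<lambda>u. f u + g u) \<in> smooth_closure S" for j
    by (rule smooth_closure.cong[OF *[of j]]) (use add pd_add in metis)
  moreover have "has_pd j (\<lambda>u. f u + g u) u" if "u \<in> S" for j u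
    using add pd_add that by blast
  ultimately show ?case using add by (auto intro: continuous_on_add)
next
  case (mult f g)
  have *: "(\<lambda>u. pd j f u * g u + pd j g u * f u) \<in> smooth_closure S" for j
    using mult by (intro smooth_closure.add smooth_closure.mult) auto
  have "pd j (\<lambda>u. f u * g u) \<in> smooth_closure S" for j
    by (rule smooth_closure.cong[OF *[of j]]) (use mult pd_mult in metis)
  moreover have "has_pd j (\<lambda>u. f u * g u) u" if "u \<in> S" for j u
    using mult pd_mult that by blast
  ultimately show ?case using mult by (auto intro: continuous_on_mult)
next
  case (inverse f)
  have *: "(\<lambda>u. -1 * (pd j f u * (inverse (f u) * inverse (f u)))) \<in> smooth_closure S" for j
    using inverse.IH inverse.hyps
    by (intro smooth_closure.mult smooth_closure.inverse smooth_closure.const) auto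
  have "pd j (\<lambda>u. inverse (f u)) \<in> smooth_closure S" for j
    by (rule smooth_closure.cong[OF *[of j]]) (use inverse pd_inverse in metis)
  moreover have "has_pd j (\<lambda>u. inverse (f u)) u" if "u \<in> S" for j u
    using inverse pd_inverse that by blast
  ultimately show ?case using inverse by (auto intro: continuous_on_inverse)
next
  case (cong f g)
  have "pd j g \<in> smooth_closure S" for j
  proof (rule smooth_closure.cong)
    show "pd j f \<in> smooth_closure S" using cong by blast
    show "\<forall>u\<in>S. pd j f u = pd j g u" using pd_cong_on[OF S] cong by blast
  qed
  moreover have "continuous_on S g" using cong continuous_on_cong by metis
  ultimately show ?case using cong has_pd_cong_on[OF S] by blast
qed

lemma smooth_closure_imp_smooth:
  assumes S: "open S" and f: "f \<in> smooth_closure S"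
  shows "smooth_on_nbhd S f"
proof -
  have "foldr pd js f \<in> smooth_closure S" for js
    by (induction js) (use f smooth_closure_step[OF S] in auto)
  then show ?thesis
    using smooth_closure_step[OF S] unfolding smooth_on_nbhd_def has_pd_def by blast
qed

lemma smooth_germsI:
  "open S \<Longrightarrow> 0 \<in> S \<Longrightarrow> f \<in> smooth_closure S \<Longrightarrow> x = germ_of f \<Longrightarrow> x \<in> smooth_germs"
  unfolding smooth_germs_def using smooth_closure_imp_smooth by blast

lemma smooth_closure_subset:
  assumes "open S" "S \<subseteq> T" "open T" "f \<in> smooth_closure T"
  shows "f \<in> smooth_closure S"
proof (rule smooth_closure.base)
  show "smooth_on_nbhd S f"
    using smooth_closure_imp_smooth[OF assms(3,4)] assms(2)
    unfolding smooth_on_nbhd_def by (meson continuous_on_subset subsetD)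
qed

lemma smooth_germsE:
  assumes "x \<in> smooth_germs"
  obtains f S where "open S" "0 \<in> S" "f \<in> smooth_closure S" "x = germ_of f"
  using assms unfolding smooth_germs_def by (auto intro: smooth_closure.base)

lemma smooth_germsE2:
  assumes "x \<in> smooth_germs" "y \<in> smooth_germs"
  obtains f g S where "open S" "0 \<in> S" "f \<in> smooth_closure S" "x = germ_of f"
    "g \<in> smooth_closure S" "y = germ_of g"
proof -
  obtain f S where f: "open S" "0 \<in> S" "f \<in> smooth_closure S" "x = germ_of f"
    using assms(1) by (rule smooth_germsE)
  obtain g T where g: "open T" "0 \<in> T" "g \<in> smooth_closure T" "y = germ_of g"
    using assms(2) by (rule smooth_germsE)
  show ?thesis
    by (rule that[of "S \<inter> T" f g]) (use f g in \<open>auto intro: smooth_closure_subset[of "S \<inter> T" S]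
      smooth_closure_subset[of "S \<inter> T" T]\<close>)
qed

lemma coefficient_ring_smooth:
  "coefficient_ring (smooth_ring :: (('a::real_normed_field, 'k::finite) germ, 'k, 'a) coeff_ring)"
proof
  show "1 \<in> coeffs (smooth_ring :: (('a, 'k) germ, 'k, 'a) coeff_ring)"
    by (simp add: smooth_ring_def)
      (rule smooth_germsI[of UNIV "\<lambda>_. 1"], auto simp: one_germ.abs_eq intro: smooth_closure.const)
  fix x y :: "('a, 'k) germ" and j :: 'k and r :: real
  assume "x \<in> coeffs smooth_ring"
  then have x: "x \<in> smooth_germs" by (simp add: smooth_ring_def)
  show "r *\<^sub>R x \<in> coeffs smooth_ring"
  proof -
    obtain f S where f: "open S" "0 \<in> S" "f \<in> smooth_closure S" "x = germ_of f"
      using x by (rule smooth_germsE)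
    have "(\<lambda>u. of_real r * f u) \<in> smooth_closure S"
      using f by (intro smooth_closure.mult smooth_closure.const)
    then have "r *\<^sub>R x \<in> smooth_germs"
      by (rule smooth_germsI[OF f(1,2)]) (unfold f(4) scaleR_germ.abs_eq, simp add: scaleR_conv_of_real)
    then show ?thesis by (simp add: smooth_ring_def)
  qed
  show "du smooth_ring j x \<in> coeffs smooth_ring"
  proof -
    obtain f S where f: "open S" "0 \<in> S" "f \<in> smooth_closure S" "x = germ_of f"
      using x by (rule smooth_germsE)
    then have "pd j f \<in> smooth_closure S" using smooth_closure_step by blast
    then show ?thesis
      using f by (auto simp: smooth_ring_def germ_pd.abs_eq intro: smooth_germsI)
  qed
  show "\<exists>y\<in>coeffs smooth_ring. x * y = 1" if "at0 smooth_ring x \<noteq> 0"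
  proof -
    obtain f S where f: "open S" "0 \<in> S" "f \<in> smooth_closure S" "x = germ_of f"
      using x by (rule smooth_germsE)
    have "f 0 \<noteq> 0" using that f by (simp add: smooth_ring_def germ_at0.abs_eq)
    define T where "T = S \<inter> f -` (- {0})"
    have T: "open T" "0 \<in> T" "T \<subseteq> S" "\<forall>u\<in>T. f u \<noteq> 0"
      using f \<open>f 0 \<noteq> 0\<close> smooth_closure_step[OF f(1,3)]
      by (auto simp: T_def intro!: continuous_open_preimage)
    have "(\<lambda>u. inverse (f u)) \<in> smooth_closure T"
      using T f by (intro smooth_closure.inverse smooth_closure_subset[of T S])
    then have "germ_of (\<lambda>u. inverse (f u)) \<in> smooth_germs"
      using T by (auto intro: smooth_germsI)
    moreover have "x * germ_of (\<lambda>u. inverse (f u)) = 1"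
      unfolding f(4) times_germ.abs_eq one_germ.abs_eq by (rule germ_of_eqI[OF T(1,2)]) (use T in auto)
    ultimately show ?thesis by (auto simp: smooth_ring_def)
  qed
  assume "y \<in> coeffs smooth_ring"
  then have y: "y \<in> smooth_germs" by (simp add: smooth_ring_def)
  obtain f g S where S: "open S" "0 \<in> S" "f \<in> smooth_closure S" "x = germ_of f"
    "g \<in> smooth_closure S" "y = germ_of g"
    using x y by (rule smooth_germsE2)
  show "x + y \<in> coeffs smooth_ring"
    using S smooth_closure.add[OF S(3,5)]
    by (auto simp: smooth_ring_def plus_germ.abs_eq intro: smooth_germsI)
  show "x * y \<in> coeffs smooth_ring"
    using S smooth_closure.mult[OF S(3,5)]
    by (auto simp: smooth_ring_def times_germ.abs_eq intro: smooth_germsI)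
  show "at0 smooth_ring (x + y) = at0 smooth_ring x + at0 smooth_ring y"
    by (simp add: S smooth_ring_def plus_germ.abs_eq germ_at0.abs_eq)
  have "germ_pd j (x + y) = germ_pd j x + germ_pd j y"
    unfolding S(4,6) plus_germ.abs_eq germ_pd.abs_eq
    by (rule germ_of_eqI[OF S(1,2)]) (use smooth_closure_step[OF S(1)] S pd_add in blast)
  then show "du smooth_ring j (x + y) = du smooth_ring j x + du smooth_ring j y"
    by (simp add: smooth_ring_def)
qed

lemma join_0_axis: "join (0::'a::real_normed_field ^ 'm::finite) (u + axis j t) = join 0 u + axis (Inr j) t"
  by (auto simp: join_def vec_eq_iff axis_def split: sum.split)

lemma continuous_on_join: "continuous_on UNIV (join (0::'a::real_normed_field ^ 'm::finite) :: 'a ^ 'k::finite \<Rightarrow> _)"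
  unfolding join_def
proof (rule continuous_on_vec_lambda)
  show "continuous_on UNIV (\<lambda>u. case i of Inl i \<Rightarrow> (0::'a ^ 'm) $ i | Inr j \<Rightarrow> u $ j)" for i :: "'m + 'k"
    by (cases i) (auto intro!: continuous_intros)
qed

text \<open>
  Differentiating $u \mapsto f(0,u)$ in $u_j$ is differentiating $f$ in $u_j$ and then restricting, as
  an identity of total functions; so iterated derivatives commute with restriction.
\<close>

lemma smooth_germ_restrict:
  fixes x :: "('a::real_normed_field, 'm::finite + 'k::finite) germ"
  assumes "x \<in> smooth_germs"
  shows "germ_restrict x \<in> smooth_germs"
proof -
  obtain f S where f: "open S" "0 \<in> S" "f \<in> smooth_closure S" "x = germ_of f"
    using assms by (rule smooth_germsE)
  let ?J = "join (0 :: 'a ^ 'm) :: 'a ^ 'k \<Rightarrow> 'a ^ ('m + 'k)"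
  define T where "T = ?J -` S"
  have T: "open T" unfolding T_def using continuous_on_join f(1) by (rule open_vimage[rotated])
  have "?J 0 = 0" by (auto simp: join_def vec_eq_iff split: sum.split)
  then have T0: "0 \<in> T" using f by (simp add: T_def)
  have fold: "foldr pd js (\<lambda>u. f (?J u)) = (\<lambda>u. foldr pd (map Inr js) f (?J u))" for js
    by (induction js) (auto simp: pd_def join_0_axis fun_eq_iff)
  have "smooth_on_nbhd S f" using f smooth_closure_imp_smooth by blast
  then have "smooth_on_nbhd T (\<lambda>u. f (?J u))"
    unfolding smooth_on_nbhd_def fold join_0_axis
    by (auto simp: T_def intro!: continuous_on_compose2[OF _ continuous_on_subset[OF continuous_on_join]])
  then show ?thesis
    using T T0 unfolding f(4) germ_restrict.abs_eq smooth_germs_def by blast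
qed

lemma germ_expansion_smooth:
  fixes G :: "('a::real_normed_field, 'm::finite + 'k::finite) germ ^ ('m + 'k)"
  assumes "\<And>c. G $ c \<in> smooth_germs"
  shows "mcoeff (germ_expansion G $ c) \<alpha> \<in> coeffs smooth_ring"
proof -
  have A: "germ_pd j F \<in> smooth_germs" if "F \<in> smooth_germs" for j and F :: "('a, 'm + 'k) germ"
    using coefficient_ring.du_closed[OF coefficient_ring_smooth] that by (simp add: smooth_ring_def)
  have B: "r *\<^sub>R f \<in> smooth_germs" if "f \<in> smooth_germs" for r and f :: "('a, 'k) germ"
    using coefficient_ring.scaleR_closed[OF coefficient_ring_smooth] that by (simp add: smooth_ring_def)
  show ?thesis
    using mcoeff_germ_expansion_in[OF A smooth_germ_restrict B assms] by (simp add: smooth_ring_def)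
qed

section \<open>Convergent power series\<close>


lemma summable_on_finite_sum:
  fixes f :: "'b \<Rightarrow> 'i \<Rightarrow> real"
  shows "(\<And>b. b \<in> B \<Longrightarrow> f b summable_on A) \<Longrightarrow> (\<lambda>x. \<Sum>b\<in>B. f b x) summable_on A"
  by (induction B rule: infinite_finite_induct) (auto intro: summable_on_add)

text \<open>
  In finite dimension, unconditional summability is absolute summability of each coordinate.
\<close>

lemma summable_on_imp_abs_summable_on_euclidean:
  fixes f :: "'i \<Rightarrow> 'a::euclidean_space"
  assumes "f summable_on A"
  shows "(\<lambda>x. norm (f x)) summable_on A"
proof (rule Infinite_Sum.abs_summable_on_comparison_test')
  have "(\<lambda>x. norm (f x \<bullet> b)) summable_on A" for b
    using summable_on_bounded_linear[OF bounded_linear_inner_left assms]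
    by (rule summable_on_iff_abs_summable_on_real[THEN iffD1])
  then show "(\<lambda>x. \<Sum>b\<in>Basis. \<bar>f x \<bullet> b\<bar>) summable_on A"
    by (intro summable_on_finite_sum) (simp_all only: real_norm_def)
  show "norm (f x) \<le> (\<Sum>b\<in>Basis. \<bar>f x \<bullet> b\<bar>)" for x
    by (rule norm_le_l1)
qed

text \<open>
  The double family of products is absolutely summable, and grouping it by $\alpha + \beta$
  instead of by rows does not change its sum.
\<close>

lemma cauchy_product_has_sum:
  fixes f g :: "nat ^ 'm::finite \<Rightarrow> 'b::{real_normed_field, banach}"
  assumes f: "(\<lambda>\<alpha>. norm (f \<alpha>)) summable_on UNIV" and g: "(\<lambda>\<alpha>. norm (g \<alpha>)) summable_on UNIV"
  shows "((\<lambda>\<gamma>. \<Sum>(\<alpha>, \<beta>)\<in>{(\<alpha>, \<beta>). \<alpha> + \<beta> = \<gamma>}. f \<alpha> * g \<beta>) has_sum (infsum f UNIV * infsum g UNIV)) UNIV"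
proof -
  define P where "P = (\<lambda>(\<alpha>, \<beta>). f \<alpha> * g \<beta>)"
  have "(\<lambda>p. norm (P p)) summable_on (UNIV \<times> UNIV)"
  proof (rule summable_on_SigmaI)
    show "((\<lambda>\<beta>. norm (P (\<alpha>, \<beta>))) has_sum (norm (f \<alpha>) * infsum (\<lambda>\<beta>. norm (g \<beta>)) UNIV)) UNIV" for \<alpha>
      unfolding P_def using g by (auto simp: norm_mult intro!: has_sum_cmult_right)
    show "(\<lambda>\<alpha>. norm (f \<alpha>) * infsum (\<lambda>\<beta>. norm (g \<beta>)) UNIV) summable_on UNIV"
      using f by (rule summable_on_cmult_left)
  qed auto
  then have P: "P summable_on (UNIV \<times> UNIV)" by (rule abs_summable_summable)
  have "infsum P (UNIV \<times> UNIV) = (\<Sum>\<^sub>\<infinity>\<alpha>. \<Sum>\<^sub>\<infinity>\<beta>. P (\<alpha>, \<beta>))"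
    by (rule infsum_Sigma_banach[OF P, symmetric])
  also have "\<dots> = infsum f UNIV * infsum g UNIV"
    using f g by (simp add: P_def infsum_cmult_right infsum_cmult_left abs_summable_summable)
  finally have "(P has_sum (infsum f UNIV * infsum g UNIV)) (UNIV \<times> UNIV)"
    using P by (metis has_sum_infsum)
  also have "?this \<longleftrightarrow> ((\<lambda>(\<gamma>, p). P p) has_sum (infsum f UNIV * infsum g UNIV))
      (Sigma UNIV (\<lambda>\<gamma>. {(\<alpha>, \<beta>). \<alpha> + \<beta> = \<gamma>}))"
    by (rule has_sum_reindex_bij_witness[where i = snd and j = "\<lambda>p. (fst p + snd p, p)"]) auto
  finally have "((\<lambda>(\<gamma>, p). P p) has_sum (infsum f UNIV * infsum g UNIV))
      (Sigma UNIV (\<lambda>\<gamma>. {(\<alpha>, \<beta>). \<alpha> + \<beta> = \<gamma>}))" .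
  moreover have "((\<lambda>p. (\<lambda>(\<gamma>, p). P p) (\<gamma>, p)) has_sum
      (\<Sum>(\<alpha>, \<beta>)\<in>{(\<alpha>, \<beta>). \<alpha> + \<beta> = \<gamma>}. f \<alpha> * g \<beta>)) {(\<alpha>, \<beta>). \<alpha> + \<beta> = \<gamma>}" for \<gamma>
    using has_sum_finite[OF finite_mindex_sum, of P \<gamma>] by (simp add: P_def)
  ultimately show ?thesis
    by (intro has_sum_SigmaD[where f = "\<lambda>(\<gamma>, p). P p" and B = "\<lambda>\<gamma>. {(\<alpha>, \<beta>). \<alpha> + \<beta> = \<gamma>}"])
qed

definition monomial :: "'a::comm_semiring_1 ^ 'n::finite \<Rightarrow> nat ^ 'n \<Rightarrow> 'a" where
  "monomial u \<alpha> = (\<Prod>j\<in>UNIV. u $ j ^ \<alpha> $ j)"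

text \<open>
  Absolute convergence at $(r, \dots, r)$, hence on the whole polydisc of radius \<open>r\<close>.
\<close>

definition summable_at :: "real \<Rightarrow> ('a::real_normed_field, 'n::finite) mfps \<Rightarrow> bool" where
  "summable_at r p \<longleftrightarrow> (\<lambda>\<alpha>. norm (mcoeff p \<alpha>) * r ^ mdeg \<alpha>) summable_on UNIV"

definition psum :: "('a::real_normed_field, 'n::finite) mfps \<Rightarrow> 'a ^ 'n \<Rightarrow> 'a" where
  "psum p u = (\<Sum>\<^sub>\<infinity>\<alpha>. mcoeff p \<alpha> * monomial u \<alpha>)"

definition polydisc :: "real \<Rightarrow> ('a::real_normed_field ^ 'n::finite) set" where
  "polydisc r = {u. \<forall>j. norm (u $ j) < r}"

lemma polydiscD: "u \<in> polydisc r \<Longrightarrow> norm (u $ j) < r"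
  by (simp add: polydisc_def)

lemma polydisc_mono: "r \<le> s \<Longrightarrow> polydisc r \<subseteq> polydisc s"
  unfolding polydisc_def by (auto intro: order_less_le_trans)

lemma open_polydisc: "open (polydisc r)"
proof -
  have "polydisc r = (\<Inter>j\<in>UNIV. {u. norm (u $ j) < r})" by (auto simp: polydisc_def)
  also have "open \<dots>"
    by (intro open_INT ballI open_Collect_less continuous_on_norm continuous_on_component
        continuous_on_id continuous_on_const) simp
  finally show ?thesis .
qed

lemma zero_in_polydisc: "0 < r \<Longrightarrow> 0 \<in> polydisc r"
  by (simp add: polydisc_def)

lemma monomial_add: "monomial u (\<alpha> + \<beta>) = monomial u \<alpha> * monomial u \<beta>"
  by (simp add: monomial_def power_add prod.distrib)

lemma norm_monomial_le:
  fixes u :: "'a::real_normed_field ^ 'n::finite"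
  assumes "\<And>j. norm (u $ j) \<le> r"
  shows "norm (monomial u \<alpha>) \<le> r ^ mdeg \<alpha>"
proof -
  have "norm (monomial u \<alpha>) = (\<Prod>j\<in>UNIV. norm (u $ j) ^ \<alpha> $ j)"
    by (simp add: monomial_def prod_norm[symmetric] norm_power)
  also have "\<dots> \<le> (\<Prod>j\<in>UNIV. r ^ \<alpha> $ j)"
    using assms by (intro prod_mono) (auto intro: power_mono)
  also have "\<dots> = r ^ mdeg \<alpha>" by (simp add: mdeg_def power_sum)
  finally show ?thesis .
qed

lemma summable_at_abs:
  fixes p :: "('a::real_normed_field, 'n::finite) mfps"
  assumes "summable_at r p" "u \<in> polydisc r"
  shows "(\<lambda>\<alpha>. norm (mcoeff p \<alpha> * monomial u \<alpha>)) summable_on UNIV"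
proof (rule Infinite_Sum.abs_summable_on_comparison_test')
  show "(\<lambda>\<alpha>. norm (mcoeff p \<alpha>) * r ^ mdeg \<alpha>) summable_on UNIV"
    using assms(1) by (simp add: summable_at_def)
  show "norm (mcoeff p \<alpha> * monomial u \<alpha>) \<le> norm (mcoeff p \<alpha>) * r ^ mdeg \<alpha>" for \<alpha>
    unfolding norm_mult
    by (intro mult_left_mono norm_monomial_le less_imp_le polydiscD[OF assms(2)] norm_ge_zero)
qed

lemma has_sum_psum:
  fixes p :: "('a::{real_normed_field, banach}, 'n::finite) mfps"
  assumes "summable_at r p" "u \<in> polydisc r"
  shows "((\<lambda>\<alpha>. mcoeff p \<alpha> * monomial u \<alpha>) has_sum psum p u) UNIV"
  unfolding psum_def by (rule has_sum_infsum[OF abs_summable_summable[OF summable_at_abs[OF assms]]])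

lemma summable_at_mono:
  assumes "summable_at r p" "0 \<le> s" "s \<le> r"
  shows "summable_at s p"
  unfolding summable_at_def
proof (rule summable_on_comparison_test[OF assms(1)[unfolded summable_at_def]])
  fix \<alpha>
  show "norm (mcoeff p \<alpha>) * s ^ mdeg \<alpha> \<le> norm (mcoeff p \<alpha>) * r ^ mdeg \<alpha>"
    by (intro mult_left_mono power_mono assms norm_ge_zero)
  show "0 \<le> norm (mcoeff p \<alpha>) * s ^ mdeg \<alpha>"
    using assms(2) by simp
qed

lemma summable_at_add:
  assumes "summable_at r p" "summable_at r q" "0 \<le> r"
  shows "summable_at r (p + q)"
  unfolding summable_at_def
proof (rule summable_on_comparison_test[OF summable_on_add[OF assms(1,2)[unfolded summable_at_def]]])
  fix \<alpha>
  show "norm (mcoeff (p + q) \<alpha>) * r ^ mdeg \<alpha> \<le>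
      norm (mcoeff p \<alpha>) * r ^ mdeg \<alpha> + norm (mcoeff q \<alpha>) * r ^ mdeg \<alpha>"
    unfolding distrib_right[symmetric] mcoeff_simps using assms(3)
    by (intro mult_right_mono norm_triangle_ineq zero_le_power)
  show "0 \<le> norm (mcoeff (p + q) \<alpha>) * r ^ mdeg \<alpha>"
    using assms(3) by simp
qed

lemma psum_add:
  fixes p q :: "('a::{real_normed_field, banach}, 'n::finite) mfps"
  assumes "summable_at r p" "summable_at r q" "u \<in> polydisc r"
  shows "psum (p + q) u = psum p u + psum q u"
proof -
  have "((\<lambda>\<alpha>. mcoeff (p + q) \<alpha> * monomial u \<alpha>) has_sum (psum p u + psum q u)) UNIV"
    using has_sum_add[OF has_sum_psum[OF assms(1,3)] has_sum_psum[OF assms(2,3)]]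
    by (simp add: distrib_right)
  then show ?thesis unfolding psum_def[of "p + q"] by (rule infsumI)
qed

lemma summable_at_mult:
  fixes p q :: "('a::real_normed_field, 'n::finite) mfps"
  assumes "summable_at r p" "summable_at r q" "0 \<le> r"
  shows "summable_at r (p * q)"
  unfolding summable_at_def
proof (rule summable_on_comparison_test)
  let ?f = "\<lambda>p \<alpha>. norm (mcoeff p \<alpha> :: 'a) * r ^ mdeg \<alpha>"
  have "(\<lambda>\<gamma>. \<Sum>(\<alpha>, \<beta>)\<in>{(\<alpha>, \<beta>). \<alpha> + \<beta> = \<gamma>}. ?f p \<alpha> * ?f q \<beta>) summable_on UNIV"
    using assms by (intro has_sum_imp_summable[OF cauchy_product_has_sum]) (auto simp: summable_at_def)
  then show "(\<lambda>\<gamma>. \<Sum>(\<alpha>, \<beta>)\<in>{(\<alpha>, \<beta>). \<alpha> + \<beta> = \<gamma>}. ?f p \<alpha> * ?f q \<beta>) summable_on UNIV" .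
  fix \<gamma> :: "nat ^ 'n"
  have "norm (mcoeff (p * q) \<gamma>) \<le> (\<Sum>(\<alpha>, \<beta>)\<in>{(\<alpha>, \<beta>). \<alpha> + \<beta> = \<gamma>}. norm (mcoeff p \<alpha>) * norm (mcoeff q \<beta>))"
    unfolding mcoeff_mult by (rule order_trans[OF norm_sum]) (simp add: case_prod_unfold norm_mult)
  then have "norm (mcoeff (p * q) \<gamma>) * r ^ mdeg \<gamma> \<le>
      (\<Sum>(\<alpha>, \<beta>)\<in>{(\<alpha>, \<beta>). \<alpha> + \<beta> = \<gamma>}. norm (mcoeff p \<alpha>) * norm (mcoeff q \<beta>)) * r ^ mdeg \<gamma>"
    using assms(3) by (intro mult_right_mono) auto
  also have "\<dots> = (\<Sum>(\<alpha>, \<beta>)\<in>{(\<alpha>, \<beta>). \<alpha> + \<beta> = \<gamma>}. ?f p \<alpha> * ?f q \<beta>)"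
    unfolding sum_distrib_right by (intro sum.cong) (auto simp: power_add)
  finally show "?f (p * q) \<gamma> \<le> (\<Sum>(\<alpha>, \<beta>)\<in>{(\<alpha>, \<beta>). \<alpha> + \<beta> = \<gamma>}. ?f p \<alpha> * ?f q \<beta>)" .
  show "0 \<le> ?f (p * q) \<gamma>" using assms(3) by simp
qed

lemma psum_mult:
  fixes p q :: "('a::{real_normed_field, banach}, 'n::finite) mfps"
  assumes "summable_at r p" "summable_at r q" "u \<in> polydisc r"
  shows "psum (p * q) u = psum p u * psum q u"
proof -
  have "((\<lambda>\<gamma>. \<Sum>(\<alpha>, \<beta>)\<in>{(\<alpha>, \<beta>). \<alpha> + \<beta> = \<gamma>}. (mcoeff p \<alpha> * monomial u \<alpha>) * (mcoeff q \<beta> * monomial u \<beta>))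
      has_sum (psum p u * psum q u)) UNIV"
    unfolding psum_def using assms by (intro cauchy_product_has_sum summable_at_abs)
  moreover have "(\<Sum>(\<alpha>, \<beta>)\<in>{(\<alpha>, \<beta>). \<alpha> + \<beta> = \<gamma>}. (mcoeff p \<alpha> * monomial u \<alpha>) * (mcoeff q \<beta> * monomial u \<beta>)) =
      mcoeff (p * q) \<gamma> * monomial u \<gamma>" for \<gamma>
    unfolding mcoeff_mult sum_distrib_right by (intro sum.cong) (auto simp: monomial_add)
  ultimately show ?thesis unfolding psum_def[of "p * q"] by (simp add: infsumI)
qed

lemma summable_at_const: "summable_at r (mmonom 0 c)"
  and psum_const: "psum (mmonom 0 c) u = c"
proof -
  have *: "((\<lambda>\<alpha>. mcoeff (mmonom 0 c) \<alpha> * monomial u \<alpha>) has_sum c) UNIV"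
    by (rule has_sum_finite_neutralI[of "{0}"]) (auto simp: monomial_def)
  show "psum (mmonom 0 c) u = c" unfolding psum_def using * by (rule infsumI)
  have "((\<lambda>\<alpha>. norm (mcoeff (mmonom 0 c) \<alpha>) * r ^ mdeg \<alpha>) has_sum norm c) UNIV"
    by (rule has_sum_finite_neutralI[of "{0}"]) auto
  then show "summable_at r (mmonom 0 c)" unfolding summable_at_def by (rule has_sum_imp_summable)
qed

lemma psum_0: "psum p 0 = mcoeff p 0" for p :: "('a::real_normed_field, 'n::finite) mfps"
proof -
  have "monomial (0 :: 'a ^ 'n) \<alpha> = (if \<alpha> = 0 then 1 else 0)" for \<alpha>
    by (auto simp: monomial_def vec_eq_iff)
  then have "((\<lambda>\<alpha>. mcoeff p \<alpha> * monomial 0 \<alpha>) has_sum mcoeff p 0) UNIV"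
    by (intro has_sum_finite_neutralI[of "{0}"]) auto
  then show ?thesis unfolding psum_def by (rule infsumI)
qed

lemma component_le_mdeg: "\<alpha> $ i \<le> mdeg \<alpha>"
  unfolding mdeg_def by (rule member_le_sum) auto

lemma finite_mdeg_le: "finite {\<gamma> :: nat ^ 'm::finite. mdeg \<gamma> \<le> N}"
proof (rule finite_subset[OF _ finite_mindex_le])
  show "{\<gamma> :: nat ^ 'm. mdeg \<gamma> \<le> N} \<subseteq> {\<alpha>. \<forall>i. \<alpha> $ i \<le> (\<chi> i. N) $ i}"
    using component_le_mdeg order_trans by fastforce
qed

text \<open>
  Without constant term every coefficient gains at least one factor $t$ when the radius shrinks from
  $r$ to $t r$, so the majorant sum can be made as small as desired.
\<close>

lemma summable_at_small:
  fixes q :: "('a::real_normed_field, 'n::finite) mfps"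
  assumes r: "0 < r" and q: "summable_at r q" "order_ge 1 q"
  obtains s where "0 < s" "s \<le> r" "summable_at s q" "(\<Sum>\<^sub>\<infinity>\<alpha>. norm (mcoeff q \<alpha>) * s ^ mdeg \<alpha>) \<le> 1 / 2"
proof -
  define M where "M = (\<Sum>\<^sub>\<infinity>\<alpha>. norm (mcoeff q \<alpha>) * r ^ mdeg \<alpha>)"
  \<comment> \<open>Chosen such that $t M \le 1/2$; the summand 1 keeps $t$ defined and at most 1 when $M = 0$.\<close>
  define t where "t = 1 / (2 * (M + 1))"
  have "M \<ge> 0" unfolding M_def using r by (intro infsum_nonneg) auto
  then have t: "0 < t" "t \<le> 1" "t * M \<le> 1 / 2"
    by (auto simp: t_def field_simps)
  have s: "0 < t * r" "t * r \<le> r" using t r by (auto intro: mult_left_le_one_le)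
  then have qs: "summable_at (t * r) q" by (intro summable_at_mono[OF q(1)]) auto
  have M': "((\<lambda>\<alpha>. t * (norm (mcoeff q \<alpha>) * r ^ mdeg \<alpha>)) has_sum (t * M)) UNIV"
    unfolding M_def using q(1) by (intro has_sum_cmult_right has_sum_infsum) (simp add: summable_at_def)
  have Q: "((\<lambda>\<alpha>. norm (mcoeff q \<alpha>) * (t * r) ^ mdeg \<alpha>) has_sum
      (\<Sum>\<^sub>\<infinity>\<alpha>. norm (mcoeff q \<alpha>) * (t * r) ^ mdeg \<alpha>)) UNIV"
    using qs by (intro has_sum_infsum) (simp add: summable_at_def)
  have "norm (mcoeff q \<alpha>) * (t * r) ^ mdeg \<alpha> \<le> t * (norm (mcoeff q \<alpha>) * r ^ mdeg \<alpha>)" for \<alpha>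
  proof (cases "\<alpha> = 0")
    case True
    then show ?thesis using q(2) by (simp add: order_ge_def)
  next
    case False
    then have "1 \<le> mdeg \<alpha>" using mdeg_eq_0_iff[of \<alpha>] by linarith
    then have "t ^ mdeg \<alpha> \<le> t"
      using power_decreasing[of 1 "mdeg \<alpha>" t] t by simp
    then have "norm (mcoeff q \<alpha>) * r ^ mdeg \<alpha> * t ^ mdeg \<alpha> \<le> norm (mcoeff q \<alpha>) * r ^ mdeg \<alpha> * t"
      using r by (intro mult_left_mono) auto
    then show ?thesis by (simp add: power_mult_distrib mult_ac)
  qed
  then have "(\<Sum>\<^sub>\<infinity>\<alpha>. norm (mcoeff q \<alpha>) * (t * r) ^ mdeg \<alpha>) \<le> t * M"
    by (rule has_sum_mono[OF Q M'])
  with t(3) s qs show ?thesis by (intro that) auto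
qed

text \<open>
  From $g = 1 + q g$ the partial sums $B_N = \sum_{|\gamma| \le N} |g_\gamma| s^{|\gamma|}$
  satisfy $B_N \le 1 + \frac12 B_N$, because a product of degree at most $N$ involves only
  coefficients of degree at most $N$. Hence $B_N \le 2$.
\<close>

lemma summable_at_geometric:
  fixes q g :: "('a::real_normed_field, 'n::finite) mfps"
  assumes s: "0 < s" "summable_at s q" and half: "(\<Sum>\<^sub>\<infinity>\<alpha>. norm (mcoeff q \<alpha>) * s ^ mdeg \<alpha>) \<le> 1 / 2"
    and g: "(1 - q) * g = 1"
  shows "summable_at s g"
proof -
  define a where "a \<alpha> = norm (mcoeff q \<alpha>) * s ^ mdeg \<alpha>" for \<alpha>
  define b where "b \<alpha> = norm (mcoeff g \<alpha>) * s ^ mdeg \<alpha>" for \<alpha>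
  have nn: "0 \<le> a \<alpha>" "0 \<le> b \<alpha>" for \<alpha> using s by (auto simp: a_def b_def)
  let ?I = "\<lambda>N. {\<gamma> :: nat ^ 'n. mdeg \<gamma> \<le> N}" and ?D = "\<lambda>\<gamma> :: nat ^ 'n. {(\<alpha>, \<beta>). \<alpha> + \<beta> = \<gamma>}"
  have g_eq: "g = 1 + q * g" using g by (simp add: algebra_simps)
  have b_le: "b \<gamma> \<le> (if \<gamma> = 0 then 1 else 0) + (\<Sum>(\<alpha>, \<beta>)\<in>?D \<gamma>. a \<alpha> * b \<beta>)" for \<gamma>
  proof -
    have "norm (mcoeff g \<gamma>) \<le> norm (mcoeff 1 \<gamma> :: 'a) + norm (mcoeff (q * g) \<gamma>)"
      by (subst g_eq) (simp only: mcoeff_simps(3) norm_triangle_ineq)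
    also have "norm (mcoeff (q * g) \<gamma>) \<le> (\<Sum>(\<alpha>, \<beta>)\<in>?D \<gamma>. norm (mcoeff q \<alpha>) * norm (mcoeff g \<beta>))"
      unfolding mcoeff_mult by (rule order_trans[OF norm_sum]) (simp add: case_prod_unfold norm_mult)
    finally have "b \<gamma> \<le> (norm (mcoeff 1 \<gamma> :: 'a) + (\<Sum>(\<alpha>, \<beta>)\<in>?D \<gamma>. norm (mcoeff q \<alpha>) * norm (mcoeff g \<beta>))) * s ^ mdeg \<gamma>"
      unfolding b_def using s by (intro mult_right_mono) auto
    also have "\<dots> = (if \<gamma> = 0 then 1 else 0) + (\<Sum>(\<alpha>, \<beta>)\<in>?D \<gamma>. a \<alpha> * b \<beta>)"
      unfolding distrib_right sum_distrib_right
      by (intro arg_cong2[of _ _ _ _ "(+)"] sum.cong) (auto simp: a_def b_def power_add)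
    finally show ?thesis .
  qed
  have bound: "sum b (?I N) \<le> 2" for N
  proof -
    have "sum b (?I N) \<le> (\<Sum>\<gamma>\<in>?I N. (if \<gamma> = 0 then 1 else 0) + (\<Sum>(\<alpha>, \<beta>)\<in>?D \<gamma>. a \<alpha> * b \<beta>))"
      by (intro sum_mono b_le)
    also have "\<dots> = 1 + (\<Sum>\<gamma>\<in>?I N. \<Sum>(\<alpha>, \<beta>)\<in>?D \<gamma>. a \<alpha> * b \<beta>)"
      by (simp add: sum.distrib finite_mdeg_le)
    also have "(\<Sum>\<gamma>\<in>?I N. \<Sum>(\<alpha>, \<beta>)\<in>?D \<gamma>. a \<alpha> * b \<beta>) = (\<Sum>(\<gamma>, p)\<in>Sigma (?I N) ?D. a (fst p) * b (snd p))"
      using sum.Sigma[of "?I N" ?D "\<lambda>\<gamma> p. a (fst p) * b (snd p)", OF finite_mdeg_le ballI[OF finite_mindex_sum]]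
      by (simp add: case_prod_unfold)
    also have "\<dots> = (\<Sum>p\<in>{p. mdeg (fst p + snd p) \<le> N}. a (fst p) * b (snd p))"
      by (rule sum.reindex_bij_witness[where i = "\<lambda>p. (fst p + snd p, p)" and j = snd]) auto
    also have "\<dots> \<le> (\<Sum>p\<in>?I N \<times> ?I N. a (fst p) * b (snd p))"
      by (rule sum_mono2) (auto simp: finite_mdeg_le nn)
    also have "\<dots> = sum a (?I N) * sum b (?I N)"
      by (simp add: sum_product sum.cartesian_product case_prod_unfold)
    also have "\<dots> \<le> 1 / 2 * sum b (?I N)"
    proof (rule mult_right_mono)
      have "a summable_on UNIV" using s(2) by (simp add: summable_at_def a_def[abs_def])
      then have "sum a (?I N) \<le> infsum a UNIV"
        by (intro finite_sum_le_infsum) (auto simp: finite_mdeg_le nn)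
      also have "\<dots> \<le> 1 / 2" using half by (simp add: a_def[abs_def])
      finally show "sum a (?I N) \<le> 1 / 2" .
    qed (simp add: sum_nonneg nn)
    finally show ?thesis by simp
  qed
  show ?thesis
    unfolding summable_at_def b_def[symmetric]
  proof (rule nonneg_bdd_above_summable_on)
    show "bdd_above (sum b ` {F. F \<subseteq> UNIV \<and> finite F})"
    proof (rule bdd_aboveI2)
      fix F :: "(nat ^ 'n) set" assume "F \<in> {F. F \<subseteq> UNIV \<and> finite F}"
      then have "finite F" by simp
      have "sum b F \<le> sum b (?I (Max (mdeg ` F)))"
        by (rule sum_mono2) (auto simp: finite_mdeg_le nn \<open>finite F\<close>)
      also have "\<dots> \<le> 2" by (rule bound)
      finally show "sum b F \<le> 2" .
    qed
  qed (rule nn)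
qed

lemma psum_inverse:
  fixes p :: "('a::{real_normed_field, banach}, 'n::finite) mfps"
  assumes r: "0 < r" and p: "summable_at r p" "mcoeff p 0 \<noteq> 0"
  obtains s b where "0 < s" "s \<le> r" "summable_at s b" "p * b = 1"
proof -
  define c where "c = inverse (mcoeff p 0)"
  define q where "q = 1 - mmonom 0 c * p"
  have q1: "order_ge 1 q" unfolding q_def c_def using p(2) by (rule order_ge_one_minus_normalized)
  have "q = mmonom 0 1 + mmonom 0 (- c) * p" by (auto simp: q_def mfps_eq_iff)
  then have "summable_at r q"
    using r p(1) by (auto intro!: summable_at_add summable_at_mult summable_at_const)
  from summable_at_small[OF r this q1] obtain s where
    s: "0 < s" "s \<le> r" "summable_at s q" "(\<Sum>\<^sub>\<infinity>\<alpha>. norm (mcoeff q \<alpha>) * s ^ mdeg \<alpha>) \<le> 1 / 2" .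
  obtain g where g: "(1 - q) * g = 1" using geometric_series[OF q1] by blast
  have "summable_at s (mmonom 0 c * g)"
    using s(1) summable_at_geometric[OF s(1,3,4) g] by (intro summable_at_mult summable_at_const) auto
  moreover have "p * (mmonom 0 c * g) = 1" using g by (simp add: q_def algebra_simps)
  ultimately show ?thesis using s that by blast
qed

lemma two_mult_le_two_power: "1 \<le> m \<Longrightarrow> 2 * m \<le> (2::nat) ^ m"
  by (induction m rule: dec_induct) auto

text \<open>
  Halving the radius compensates the factor $m (m - 1)$ from the second-order remainder of $z^m$.
\<close>

lemma falling_2_le_two_power: "m * (m - 1) \<le> (2::nat) ^ m"
proof (induction m)
  case (Suc m)
  show ?case
  proof (cases "m = 0")
    case False
    then have "Suc m * (Suc m - 1) = m * (m - 1) + 2 * m" by (cases m) auto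
    then show ?thesis using Suc two_mult_le_two_power[of m] False by simp
  qed simp
qed simp

lemma summable_at_mpd:
  fixes p :: "('a::real_normed_field, 'n::finite) mfps"
  assumes r: "0 < r" and p: "summable_at r p"
  shows "summable_at (r / 2) (mpd j p)"
  unfolding summable_at_def
proof (rule summable_on_comparison_test)
  let ?h = "\<lambda>\<alpha> :: nat ^ 'n. \<alpha> + axis j 1"
  let ?f = "\<lambda>\<alpha>. norm (mcoeff p \<alpha>) * r ^ mdeg \<alpha>"
  have "?f summable_on range ?h"
    using p unfolding summable_at_def by (rule summable_on_subset_banach) simp
  then have "(?f \<circ> ?h) summable_on UNIV"
    by (subst summable_on_reindex[symmetric]) (auto intro: injI)
  then show "(\<lambda>\<alpha>. 1 / r * (?f \<circ> ?h) \<alpha>) summable_on UNIV"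
    by (rule summable_on_cmult_right)
  fix \<alpha> :: "nat ^ 'n"
  have "\<alpha> $ j + 1 \<le> 2 ^ mdeg \<alpha>"
    using component_le_mdeg[of \<alpha> j] less_exp[of "mdeg \<alpha>"] by linarith
  then have "real (\<alpha> $ j + 1) \<le> 2 ^ mdeg \<alpha>"
    using of_nat_le_iff[of "\<alpha> $ j + 1" "2 ^ mdeg \<alpha>", where 'a = real] by simp
  then have "real (\<alpha> $ j + 1) * (norm (mcoeff p (?h \<alpha>)) * (r / 2) ^ mdeg \<alpha>) \<le>
      2 ^ mdeg \<alpha> * (norm (mcoeff p (?h \<alpha>)) * (r / 2) ^ mdeg \<alpha>)"
    using r by (intro mult_right_mono) auto
  also have "\<dots> = norm (mcoeff p (?h \<alpha>)) * r ^ mdeg \<alpha>"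
    by (simp add: power_divide)
  finally show "norm (mcoeff (mpd j p) \<alpha>) * (r / 2) ^ mdeg \<alpha> \<le> 1 / r * (?f \<circ> ?h) \<alpha>"
    using r unfolding mcoeff_mpd norm_mult norm_of_nat by (simp add: mult_ac)
  show "0 \<le> norm (mcoeff (mpd j p) \<alpha>) * (r / 2) ^ mdeg \<alpha>" using r by simp
qed

text \<open>
  The factor of a monomial that does not change when only the coordinate \<open>j\<close> varies.
\<close>

definition monomial_off :: "'n \<Rightarrow> 'a::comm_semiring_1 ^ 'n::finite \<Rightarrow> nat ^ 'n \<Rightarrow> 'a" where
  "monomial_off j u \<alpha> = (\<Prod>l\<in>UNIV - {j}. u $ l ^ \<alpha> $ l)"

lemma monomial_split: "monomial u \<alpha> = u $ j ^ \<alpha> $ j * monomial_off j u \<alpha>"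
  unfolding monomial_def monomial_off_def by (rule prod.remove) auto

lemma monomial_off_cong: "(\<And>l. l \<noteq> j \<Longrightarrow> u $ l = v $ l) \<Longrightarrow> (\<And>l. l \<noteq> j \<Longrightarrow> \<alpha> $ l = \<beta> $ l) \<Longrightarrow> monomial_off j u \<alpha> = monomial_off j v \<beta>"
  unfolding monomial_off_def by (rule prod.cong) auto

lemma mdeg_split: "mdeg \<alpha> = \<alpha> $ j + (\<Sum>l\<in>UNIV - {j}. \<alpha> $ l)"
  unfolding mdeg_def by (rule sum.remove) auto

lemma has_sum_minus:
  fixes f g :: "'i \<Rightarrow> 'b::real_normed_vector"
  assumes "(f has_sum a) A" "(g has_sum b) A"
  shows "((\<lambda>x. f x - g x) has_sum (a - b)) A"
  using has_sum_add[OF assms(1), of "\<lambda>x. - g x" "- b"] assms(2) by (simp add: has_sum_uminus)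

text \<open>
  The series of the formal derivative, reindexed by the monomials of \<open>p\<close> instead of those of
  \<open>mpd j p\<close>. In this form it can be subtracted termwise from the difference quotient of \<open>p\<close>.
\<close>

lemma has_sum_psum_mpd:
  fixes p :: "('a::{real_normed_field, banach}, 'n::finite) mfps"
  assumes r: "0 < r" and p: "summable_at r p" and u: "u \<in> polydisc (r / 2)"
  shows "((\<lambda>\<beta>. mcoeff p \<beta> * (of_nat (\<beta> $ j) * u $ j ^ (\<beta> $ j - 1) * monomial_off j u \<beta>)) has_sum
    psum (mpd j p) u) UNIV"
proof -
  let ?h = "\<lambda>\<alpha> :: nat ^ 'n. \<alpha> + axis j 1"
  let ?d = "\<lambda>\<beta>. mcoeff p \<beta> * (of_nat (\<beta> $ j) * u $ j ^ (\<beta> $ j - 1) * monomial_off j u \<beta>)"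
  have "((\<lambda>\<alpha>. mcoeff (mpd j p) \<alpha> * monomial u \<alpha>) has_sum psum (mpd j p) u) UNIV"
    using summable_at_mpd[OF r p] u by (rule has_sum_psum)
  also have "(\<lambda>\<alpha>. mcoeff (mpd j p) \<alpha> * monomial u \<alpha>) = ?d \<circ> ?h"
  proof
    fix \<alpha> :: "nat ^ 'n"
    have "monomial_off j u (?h \<alpha>) = monomial_off j u \<alpha>" by (rule monomial_off_cong) (auto simp: axis_def)
    then show "mcoeff (mpd j p) \<alpha> * monomial u \<alpha> = (?d \<circ> ?h) \<alpha>"
      unfolding monomial_split[of _ _ j] by (simp add: axis_def)
  qed
  also have "((?d \<circ> ?h) has_sum psum (mpd j p) u) UNIV \<longleftrightarrow> (?d has_sum psum (mpd j p) u) (range ?h)"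
    by (rule has_sum_reindex[symmetric]) (auto intro: injI)
  also have "\<dots> \<longleftrightarrow> (?d has_sum psum (mpd j p) u) UNIV"
  proof (rule has_sum_cong_neutral)
    fix \<beta> :: "nat ^ 'n" assume "\<beta> \<in> UNIV - range ?h"
    have "\<beta> = ?h (\<beta> - axis j 1)" if "\<beta> $ j \<noteq> 0"
      using that by (auto simp: vec_eq_iff axis_def)
    with \<open>\<beta> \<in> _\<close> have "\<beta> $ j = 0" by blast
    then show "?d \<beta> = 0" by simp
  qed auto
  finally show ?thesis .
qed

text \<open>
  Termwise differentiation. With $K = r/2$, the difference quotient of a monomial differs from its
  derivative by at most $n (n-1) K^{|\beta| - 2} |h|$, where $n$ is the exponent of $u_j$. This is at
  most $K^{-2} r^{|\beta|} |h|$, so the sum of all the errors is $O(|h|)$.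
\<close>

lemma pd_psum:
  fixes p :: "('a::{real_normed_field, banach}, 'n::finite) mfps"
  assumes r: "0 < r" and p: "summable_at r p" and u: "u \<in> polydisc (r / 2)"
  shows "has_pd j (psum p) u \<and> pd j (psum p) u = psum (mpd j p) u"
proof (rule has_field_derivative_imp_pd)
  define K where "K = r / 2"
  define M where "M = (\<Sum>\<^sub>\<infinity>\<alpha>. norm (mcoeff p \<alpha>) * r ^ mdeg \<alpha>)"
  have K: "0 < K" "norm (u $ l) < K" "2 * K = r" for l
    using r polydiscD[OF u] by (auto simp: K_def)
  have pr: "polydisc K \<subseteq> (polydisc r :: ('a ^ 'n) set)" using r by (intro polydisc_mono) (simp add: K_def)
  have est: "norm ((psum p (u + axis j h) - psum p u) / h - psum (mpd j p) u) \<le> 1 / K ^ 2 * M * norm h"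
    if h: "h \<noteq> 0" "norm (u $ j + h) < K" for h
  proof -
    let ?v = "u + axis j h"
    have v: "?v \<in> polydisc K"
      using K h by (auto simp: polydisc_def axis_def)
    define D where "D \<beta> = (monomial ?v \<beta> - monomial u \<beta>) / h -
      of_nat (\<beta> $ j) * u $ j ^ (\<beta> $ j - 1) * monomial_off j u \<beta>" for \<beta>
    have "((\<lambda>\<beta>. (mcoeff p \<beta> * monomial ?v \<beta> - mcoeff p \<beta> * monomial u \<beta>) * (1 / h) -
        mcoeff p \<beta> * (of_nat (\<beta> $ j) * u $ j ^ (\<beta> $ j - 1) * monomial_off j u \<beta>)) has_sum
        ((psum p ?v - psum p u) * (1 / h) - psum (mpd j p) u)) UNIV"
      using v u pr
      by (intro has_sum_minus has_sum_cmult_left has_sum_psum[OF p] has_sum_psum_mpd[OF r p]) (auto simp: K_def)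
    then have 1: "((\<lambda>\<beta>. mcoeff p \<beta> * D \<beta>) has_sum ((psum p ?v - psum p u) / h - psum (mpd j p) u)) UNIV"
      by (simp add: D_def right_diff_distrib diff_divide_distrib)
    have 2: "((\<lambda>\<beta>. norm h / K ^ 2 * (norm (mcoeff p \<beta>) * r ^ mdeg \<beta>)) has_sum (norm h / K ^ 2 * M)) UNIV"
      unfolding M_def using p by (intro has_sum_cmult_right has_sum_infsum) (simp add: summable_at_def)
    have 3: "norm (D \<beta>) \<le> norm h / K ^ 2 * r ^ mdeg \<beta>" for \<beta>
    proof -
      define n where "n = \<beta> $ j"
      define m where "m = (\<Sum>l\<in>UNIV - {j}. \<beta> $ l)"
      have mn: "mdeg \<beta> = n + m" by (simp add: mdeg_split[of _ j] n_def m_def)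
      have "monomial_off j ?v \<beta> = monomial_off j u \<beta>" by (rule monomial_off_cong) (auto simp: axis_def)
      then have "D \<beta> = (((u $ j + h) ^ n - u $ j ^ n) / h - of_nat n * u $ j ^ (n - Suc 0)) * monomial_off j u \<beta>"
        unfolding D_def monomial_split[of _ _ j] n_def by (simp add: axis_def algebra_simps diff_divide_distrib)
      moreover have "norm (((u $ j + h) ^ n - u $ j ^ n) / h - of_nat n * u $ j ^ (n - Suc 0)) \<le>
          real n * real (n - Suc 0) * K ^ (n - 2) * norm h"
        using h K(2)[of j] by (intro lemma_termdiff3) auto
      moreover have "norm (monomial_off j u \<beta>) \<le> K ^ m"
      proof -
        have "norm (monomial_off j u \<beta>) = (\<Prod>l\<in>UNIV - {j}. norm (u $ l) ^ \<beta> $ l)"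
          by (simp add: monomial_off_def prod_norm[symmetric] norm_power)
        also have "\<dots> \<le> (\<Prod>l\<in>UNIV - {j}. K ^ \<beta> $ l)"
          using K by (intro prod_mono) (auto intro!: power_mono simp: less_imp_le)
        finally show ?thesis by (simp add: m_def power_sum)
      qed
      ultimately have "norm (D \<beta>) \<le> (real n * real (n - Suc 0) * K ^ (n - 2) * norm h) * K ^ m"
        using K by (simp add: norm_mult mult_mono)
      also have "\<dots> \<le> norm h / K ^ 2 * r ^ mdeg \<beta>"
      proof (cases "n < 2")
        case True
        then have "real n * real (n - Suc 0) = 0" by auto
        then have "real n * real (n - Suc 0) * K ^ (n - 2) * norm h * K ^ m = 0" by simp
        moreover have "0 \<le> norm h / K ^ 2 * r ^ mdeg \<beta>" using r by simp
        ultimately show ?thesis by linarith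
      next
        case False
        have "real n * real (n - Suc 0) = real (n * (n - 1))" by simp
        also have "\<dots> \<le> real (2 ^ n)" by (intro of_nat_mono falling_2_le_two_power)
        also have "\<dots> \<le> 2 ^ (n + m)" by simp
        finally have "real n * real (n - Suc 0) * (K ^ (n - 2) * K ^ m * norm h) \<le>
            2 ^ (n + m) * (K ^ (n - 2) * K ^ m * norm h)"
          using K by (intro mult_right_mono) auto
        moreover have "K ^ (n - 2) = K ^ n / K ^ 2"
          using False K by (simp add: power_diff)
        ultimately show ?thesis
          by (simp add: mn K(3)[symmetric] power_mult_distrib power_add mult_ac)
      qed
      finally show ?thesis .
    qed
    have "norm (mcoeff p \<beta> * D \<beta>) \<le> norm h / K ^ 2 * (norm (mcoeff p \<beta>) * r ^ mdeg \<beta>)" for \<beta>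
      using mult_left_mono[OF 3, of "norm (mcoeff p \<beta>)" \<beta>] by (simp add: norm_mult mult_ac)
    from norm_infsum_le[OF 1 2 this] show ?thesis by (simp add: mult_ac)
  qed
  have "((\<lambda>h. (psum p (u + axis j h) - psum p u) / h - psum (mpd j p) u) \<longlongrightarrow> 0) (at 0)"
  proof (rule Lim_null_comparison)
    have "((\<lambda>h. norm (u $ j + h)) \<longlongrightarrow> norm (u $ j + 0)) (at (0::'a))"
      by (intro tendsto_intros)
    then have "\<forall>\<^sub>F h in at (0::'a). norm (u $ j + h) < K"
      using K(2)[of j] by (intro order_tendstoD(2)) auto
    moreover have "\<forall>\<^sub>F h in at (0::'a). h \<noteq> 0" by (simp add: eventually_at_filter)
    ultimately show "\<forall>\<^sub>F h in at (0::'a).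
        norm ((psum p (u + axis j h) - psum p u) / h - psum (mpd j p) u) \<le> 1 / K ^ 2 * M * norm h"
      by eventually_elim (rule est)
    show "((\<lambda>h::'a. 1 / K ^ 2 * M * norm h) \<longlongrightarrow> 0) (at 0)"
      by (intro tendsto_mult_right_zero tendsto_norm_zero tendsto_ident_at)
  qed
  then show "((\<lambda>t. psum p (u + axis j t)) has_field_derivative psum (mpd j p) u) (at 0)"
    unfolding DERIV_def by (simp add: LIM_zero_iff)
qed

section \<open>Analytic germs as coefficients\<close>

text \<open>
  The definition asks for convergence at every point of a polydisc. Evaluated at the single point
  $(r/2, \dots, r/2)$ this already yields absolute convergence with radius $r/2$.
\<close>

lemma analytic_germs_iff:
  fixes x :: "('a::{real_normed_field, euclidean_space}, 'n::finite) germ"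
  shows "x \<in> analytic_germs \<longleftrightarrow> (\<exists>p r. 0 < r \<and> summable_at r p \<and> x = germ_of (psum p))"
proof
  assume "x \<in> analytic_germs"
  then obtain f a r where r: "0 < r" and x: "x = germ_of f"
    and f: "\<And>u. u \<in> polydisc r \<Longrightarrow> ((\<lambda>\<alpha> :: nat ^ 'n. a \<alpha> * monomial u \<alpha>) has_sum f u) UNIV"
    unfolding analytic_germs_def polydisc_def monomial_def by blast
  define p where "p = Abs_mfps a"
  have "germ_of f = germ_of (psum p)"
    by (rule germ_of_eqI[OF open_polydisc zero_in_polydisc[OF r]])
      (use f in \<open>simp add: psum_def p_def infsumI[symmetric]\<close>)
  moreover have "summable_at (r / 2) p"
  proof -
    define u where "u = ((\<chi> j. of_real (r / 2)) :: 'a ^ 'n)"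
    have "u \<in> polydisc r" using r by (simp add: u_def polydisc_def)
    then have "(\<lambda>\<alpha>. norm (a \<alpha> * monomial u \<alpha>)) summable_on UNIV"
      using f by (intro summable_on_imp_abs_summable_on_euclidean has_sum_imp_summable)
    moreover have "norm (monomial u \<alpha>) = (r / 2) ^ mdeg \<alpha>" for \<alpha>
      using r by (simp add: monomial_def u_def prod_norm[symmetric] norm_power mdeg_def power_sum)
    ultimately show ?thesis by (simp add: summable_at_def p_def norm_mult)
  qed
  ultimately show "\<exists>p r. 0 < r \<and> summable_at r p \<and> x = germ_of (psum p)"
    using r x by (intro exI[of _ p] exI[of _ "r / 2"]) auto
next
  assume "\<exists>p r. 0 < r \<and> summable_at r p \<and> x = germ_of (psum p)"
  then obtain p r where "0 < r" "summable_at r p" "x = germ_of (psum p)" by blast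
  then show "x \<in> analytic_germs"
    unfolding analytic_germs_def using has_sum_psum[of r p]
    by (auto simp: polydisc_def monomial_def intro!: imageI exI[of _ "mcoeff p"] exI[of _ r])
qed

lemma analytic_germsE2:
  fixes x y :: "('a::{real_normed_field, euclidean_space}, 'n::finite) germ"
  assumes "x \<in> analytic_germs" "y \<in> analytic_germs"
  obtains p q r where "0 < r" "summable_at r p" "x = germ_of (psum p)" "summable_at r q" "y = germ_of (psum q)"
proof -
  obtain p r where p: "0 < r" "summable_at r p" "x = germ_of (psum p)"
    using assms(1) unfolding analytic_germs_iff by blast
  obtain q s where q: "0 < s" "summable_at s q" "y = germ_of (psum q)"
    using assms(2) unfolding analytic_germs_iff by blast
  show ?thesis
    by (rule that[of "min r s" p q]) (use p q in \<open>auto intro: summable_at_mono\<close>)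
qed

lemma germ_of_psum_const: "germ_of (psum (mmonom 0 c)) = germ_of (\<lambda>_. c)"
  by (simp add: psum_const[abs_def])

lemma germ_of_psum_add:
  fixes p q :: "('a::{real_normed_field, banach}, 'n::finite) mfps"
  assumes "0 < r" "summable_at r p" "summable_at r q"
  shows "germ_of (psum (p + q)) = germ_of (psum p) + germ_of (psum q)"
  unfolding plus_germ.abs_eq
  by (rule germ_of_eqI[OF open_polydisc zero_in_polydisc[OF assms(1)] psum_add[OF assms(2,3)]])

lemma germ_of_psum_mult:
  fixes p q :: "('a::{real_normed_field, banach}, 'n::finite) mfps"
  assumes "0 < r" "summable_at r p" "summable_at r q"
  shows "germ_of (psum (p * q)) = germ_of (psum p) * germ_of (psum q)"
  unfolding times_germ.abs_eq
  by (rule germ_of_eqI[OF open_polydisc zero_in_polydisc[OF assms(1)] psum_mult[OF assms(2,3)]])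

lemma germ_pd_psum:
  fixes p :: "('a::{real_normed_field, banach}, 'n::finite) mfps"
  assumes r: "0 < r" "summable_at r p"
  shows "germ_pd j (germ_of (psum p)) = germ_of (psum (mpd j p))"
  unfolding germ_pd.abs_eq
  by (rule germ_of_eqI[OF open_polydisc[of "r / 2"]]) (use r pd_psum[OF r] in \<open>auto intro: zero_in_polydisc\<close>)

lemma coefficient_ring_analytic:
  "coefficient_ring (analytic_ring :: (('a::{real_normed_field, euclidean_space}, 'k::finite) germ, 'k, 'a) coeff_ring)"
proof
  have const: "(germ_of (\<lambda>_. c) :: ('a, 'k) germ) \<in> analytic_germs" for c
    unfolding analytic_germs_iff germ_of_psum_const[symmetric]
    by (intro exI[of _ "mmonom 0 c"] exI[of _ 1]) (simp add: summable_at_const)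
  show one: "1 \<in> coeffs (analytic_ring :: (('a, 'k) germ, 'k, 'a) coeff_ring)"
    using const[of 1] by (simp add: analytic_ring_def one_germ.abs_eq)
  have mult: "x * y \<in> analytic_germs"
    if xy: "x \<in> analytic_germs" "y \<in> analytic_germs" for x y :: "('a, 'k) germ"
  proof -
    obtain p q r where "0 < r" "summable_at r p" "x = germ_of (psum p)" "summable_at r q" "y = germ_of (psum q)"
      using xy by (rule analytic_germsE2)
    then show ?thesis
      unfolding analytic_germs_iff
      by (intro exI[of _ "p * q"] exI[of _ r]) (auto simp: germ_of_psum_mult summable_at_mult)
  qed
  fix x y :: "('a, 'k) germ" and j :: 'k and c :: real
  assume "x \<in> coeffs analytic_ring"
  then have x: "x \<in> analytic_germs" by (simp add: analytic_ring_def)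
  then obtain p r where p: "0 < r" "summable_at r p" "x = germ_of (psum p)"
    unfolding analytic_germs_iff by blast
  have "c *\<^sub>R x = germ_of (\<lambda>_. of_real c) * x"
    unfolding p(3) times_germ.abs_eq scaleR_germ.abs_eq by (simp add: scaleR_conv_of_real)
  then show "c *\<^sub>R x \<in> coeffs analytic_ring"
    using mult[OF const x] by (simp add: analytic_ring_def)
  show "du analytic_ring j x \<in> coeffs analytic_ring"
    unfolding p(3)
    by (simp add: analytic_ring_def germ_pd_psum[OF p(1,2)] analytic_germs_iff)
      (use summable_at_mpd[OF p(1,2)] half_gt_zero[OF p(1)] in blast)
  show "\<exists>y\<in>coeffs analytic_ring. x * y = 1" if "at0 analytic_ring x \<noteq> 0"
  proof -
    have "mcoeff p 0 \<noteq> 0"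
      using that by (simp add: analytic_ring_def p(3) germ_at0.abs_eq psum_0)
    with p(1,2) obtain s b where b: "0 < s" "s \<le> r" "summable_at s b" "p * b = 1"
      by (rule psum_inverse)
    then have ps: "summable_at s p" by (intro summable_at_mono[OF p(2)]) auto
    have "x * germ_of (psum b) = germ_of (psum (mmonom 0 1))"
    proof -
      have "mmonom 0 1 = (1 :: ('a, 'k) mfps)" by (simp add: mfps_eq_iff)
      then show ?thesis using germ_of_psum_mult[OF b(1) ps b(3)] b(4) p(3) by simp
    qed
    also have "\<dots> = 1" unfolding germ_of_psum_const one_germ.abs_eq ..
    finally have "x * germ_of (psum b) = 1" .
    moreover have "germ_of (psum b) \<in> coeffs analytic_ring"
      using b(1,3) by (auto simp: analytic_ring_def analytic_germs_iff)
    ultimately show ?thesis by blast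
  qed
  assume "y \<in> coeffs analytic_ring"
  then have y: "y \<in> analytic_germs" by (simp add: analytic_ring_def)
  show "x * y \<in> coeffs analytic_ring"
    using mult[OF x y] by (simp add: analytic_ring_def)
  obtain p q r where r: "0 < r" and p: "summable_at r p" "x = germ_of (psum p)"
    and q: "summable_at r q" "y = germ_of (psum q)"
    using x y by (rule analytic_germsE2)
  have pq: "summable_at r (p + q)" using p q r by (simp add: summable_at_add)
  have sum: "x + y = germ_of (psum (p + q))" using germ_of_psum_add[OF r p(1) q(1)] p q by simp
  then show "x + y \<in> coeffs analytic_ring"
    using r pq by (auto simp: analytic_ring_def analytic_germs_iff)
  show "at0 analytic_ring (x + y) = at0 analytic_ring x + at0 analytic_ring y"
    unfolding p(2) q(2) plus_germ.abs_eq by (simp add: analytic_ring_def germ_at0.abs_eq)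
  have "germ_pd j (x + y) = germ_pd j x + germ_pd j y"
    unfolding sum unfolding p(2) q(2) germ_pd_psum[OF r pq] germ_pd_psum[OF r p(1)] germ_pd_psum[OF r q(1)] mpd_add
    using r p q by (intro germ_of_psum_add[of "r / 2"] summable_at_mpd) auto
  then show "du analytic_ring j (x + y) = du analytic_ring j x + du analytic_ring j y"
    by (simp add: analytic_ring_def)
qed

text \<open>
  Restricting to $x = 0$ keeps exactly the monomials without $x$, that is, the multi-indices in the
  range of \<open>join 0\<close>.
\<close>

lemma analytic_germ_restrict:
  fixes x :: "('a::{real_normed_field, euclidean_space}, 'm::finite + 'k::finite) germ"
  assumes "x \<in> analytic_germs"
  shows "germ_restrict x \<in> analytic_germs"
proof -
  obtain p r where r: "0 < r" and p: "summable_at r p" and x: "x = germ_of (psum p)"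
    using assms unfolding analytic_germs_iff by blast
  let ?J = "join (0 :: nat ^ 'm) :: nat ^ 'k \<Rightarrow> nat ^ ('m + 'k)"
  define q where "q = Abs_mfps (\<lambda>\<beta>. mcoeff p (?J \<beta>))"
  have inj: "inj ?J"
    by (rule injI) (auto simp: join_def vec_eq_iff split_sum_all)
  have mdeg_J: "mdeg (?J \<beta>) = mdeg \<beta>" for \<beta>
    by (simp add: mdeg_def join_def UNIV_Plus_UNIV[symmetric] sum.Plus del: UNIV_Plus_UNIV)
  have "(\<lambda>\<alpha>. norm (mcoeff p \<alpha>) * r ^ mdeg \<alpha>) summable_on range ?J"
    using p unfolding summable_at_def by (rule summable_on_subset_banach) simp
  then have "summable_at r q"
    unfolding summable_on_reindex[OF inj] by (simp add: summable_at_def q_def comp_def mdeg_J)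
  moreover have "psum p (join 0 u) = psum q u" for u :: "'a ^ 'k"
  proof -
    have mon: "monomial (join (0 :: 'a ^ 'm) u) \<alpha> = (\<Prod>i\<in>UNIV. 0 ^ \<alpha> $ Inl i) * (\<Prod>j\<in>UNIV. u $ j ^ \<alpha> $ Inr j)" for \<alpha>
      by (simp add: monomial_def join_def UNIV_Plus_UNIV[symmetric] prod.Plus del: UNIV_Plus_UNIV)
    have zero: "monomial (join (0 :: 'a ^ 'm) u) \<alpha> = 0" if "\<alpha> \<notin> range ?J" for \<alpha>
    proof -
      have "\<alpha> = ?J (\<chi> j. \<alpha> $ Inr j)" if "\<forall>i. \<alpha> $ Inl i = 0"
        using that by (auto simp: join_def vec_eq_iff split: sum.split)
      with that obtain i where "\<alpha> $ Inl i \<noteq> 0" by blast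
      then show ?thesis by (auto simp: mon prod_zero_iff zero_power)
    qed
    have "psum p (join 0 u) = (\<Sum>\<^sub>\<infinity>\<alpha>\<in>range ?J. mcoeff p \<alpha> * monomial (join 0 u) \<alpha>)"
      unfolding psum_def by (rule infsum_cong_neutral) (auto simp: zero)
    also have "\<dots> = psum q u"
      unfolding infsum_reindex[OF inj] psum_def
      by (rule infsum_cong) (simp add: mon q_def comp_def, simp add: join_def monomial_def)
    finally show ?thesis .
  qed
  ultimately show ?thesis
    using r unfolding x germ_restrict.abs_eq analytic_germs_iff by auto
qed

lemma germ_expansion_analytic:
  fixes G :: "('a::{real_normed_field, euclidean_space}, 'm::finite + 'k::finite) germ ^ ('m + 'k)"
  assumes "\<And>c. G $ c \<in> analytic_germs"
  shows "mcoeff (germ_expansion G $ c) \<alpha> \<in> coeffs analytic_ring"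
proof -
  have A: "germ_pd j F \<in> analytic_germs" if "F \<in> analytic_germs" for j and F :: "('a, 'm + 'k) germ"
    using coefficient_ring.du_closed[OF coefficient_ring_analytic] that by (simp add: analytic_ring_def)
  have B: "r *\<^sub>R f \<in> analytic_germs" if "f \<in> analytic_germs" for r and f :: "('a, 'k) germ"
    using coefficient_ring.scaleR_closed[OF coefficient_ring_analytic] that by (simp add: analytic_ring_def)
  show ?thesis
    using mcoeff_germ_expansion_in[OF A analytic_germ_restrict B assms] by (simp add: analytic_ring_def)
qed

section \<open>Removal of the nonresonant terms\<close>

theorem lemma2p6:
  fixes F :: "('a::{real_normed_field, euclidean_space}, 'm::finite + 'k::finite) mfps ^ ('m + 'k)"
    and G H :: "('a, 'm + 'k) germ ^ ('m + 'k)"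
    and lamF :: "'m \<Rightarrow> ('a, 'k) mfps"
    and lamG lamH :: "'m \<Rightarrow> ('a, 'k) germ"
  shows
    "(pre_normal_form lamF (formal_expansion F) \<and> normally_hyperbolic formal_ring lamF
        \<longrightarrow> nonresonant_terms_removable formal_ring lamF (formal_expansion F))
     \<and> ((\<forall>c. G $ c \<in> smooth_germs) \<and>
          pre_normal_form lamG (germ_expansion G) \<and> normally_hyperbolic smooth_ring lamG
        \<longrightarrow> nonresonant_terms_removable smooth_ring lamG (germ_expansion G))
     \<and> ((\<forall>c. H $ c \<in> analytic_germs) \<and>
          pre_normal_form lamH (germ_expansion H) \<and> normally_hyperbolic analytic_ring lamH
        \<longrightarrow> nonresonant_terms_removable analytic_ring lamH (germ_expansion H))"
proof (intro conjI impI; elim conjE)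
  assume "pre_normal_form lamF (formal_expansion F)"
  then show "nonresonant_terms_removable formal_ring lamF (formal_expansion F)"
    by (rule coefficient_ring.nonresonant_terms_removable_if_over[OF coefficient_ring_formal]) (simp add: formal_ring_def)
next
  assume G: "\<forall>c. G $ c \<in> smooth_germs" and "pre_normal_form lamG (germ_expansion G)"
  from this(2) show "nonresonant_terms_removable smooth_ring lamG (germ_expansion G)"
    by (rule coefficient_ring.nonresonant_terms_removable_if_over[OF coefficient_ring_smooth])
      (use G in \<open>blast intro: germ_expansion_smooth\<close>)
next
  assume H: "\<forall>c. H $ c \<in> analytic_germs" and "pre_normal_form lamH (germ_expansion H)"
  from this(2) show "nonresonant_terms_removable analytic_ring lamH (germ_expansion H)"
    by (rule coefficient_ring.nonresonant_terms_removable_if_over[OF coefficient_ring_analytic])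
      (use H in \<open>blast intro: germ_expansion_analytic\<close>)
qed

end
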